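(* Let $N\ge 1$ and suppose that $u\in C_c^2(\mathbb{R}^N)$. Then for any $1\le p\le+\infty$, $$H_nu\to\nabla^2u\quad\text{in }L^p(\mathbb{R}^N,\mathbb{R}^{N\times N})\quad\text{as }n\to\infty.$$
   Context: Standing assumptions: $(\rho_n)_{n\in\mathbb{N}}$ is a sequence of radial functions on $\mathbb{R}^N$ such that for all $n$: $\rho_n\ge 0$, $\int_{\mathbb{R}^N}\rho_n(x)\,dx=1$, and $\lim_{n\to\infty}\int_{|x|>\gamma}\rho_n(x)\,dx=0$ for every $\gamma>0$. Non-local Hessian: $$H_nu(x):=\frac{N(N+2)}{2}\int_{\mathbb{R}^N}\frac{u(x+h)-2u(x)+u(x-h)}{|h|^2}\,\frac{h\otimes h-\frac{|h|^2}{N+2}I_N}{|h|^2}\,\rho_n(h)\,dh\in\mathbb{R}^{N\times N},$$ where $I_N$ is the $N\times N$ identity matrix and $h\otimes h=hh^{\top}$. $\nabla^2u$ is the classical Hessian matrix. $|\cdot|$ denotes the Euclidean norm for vectors and the Frobenius norm for matrices. *)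

theory Defs
  imports "HOL-Analysis.Analysis" "HOL-Probability.Essential_Supremum"
begin

section \<open>Functions of class $C^k$ and the classical Hessian\<close>

definition partial :: "'n::finite \<Rightarrow> (real^'n \<Rightarrow> real) \<Rightarrow> real^'n \<Rightarrow> real"
  where "partial i u x = frechet_derivative u (at x) (axis i 1)"

text \<open>The value of \<open>frechet_derivative\<close> is unspecified where no derivative exists, so
  differentiability is required explicitly at every stage.\<close>

fun Ck :: "nat \<Rightarrow> (real^'n::finite \<Rightarrow> real) \<Rightarrow> bool"
  where
    "Ck 0 u \<longleftrightarrow> continuous_on UNIV u"
  | "Ck (Suc k) u \<longleftrightarrow> (\<forall>x. u differentiable (at x)) \<and> (\<forall>i. Ck k (partial i u))"

definition compactly_supported :: "(real^'n::finite \<Rightarrow> real) \<Rightarrow> bool"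
  where "compactly_supported u \<longleftrightarrow> compact (closure {x. u x \<noteq> 0})"

definition Hessian :: "(real^'n::finite \<Rightarrow> real) \<Rightarrow> real^'n \<Rightarrow> real^'n^'n"
  where "Hessian u x = (\<chi> i j. partial i (partial j u) x)"


section \<open>The non-local Hessian\<close>

definition radial :: "(real^'n::finite \<Rightarrow> real) \<Rightarrow> bool"
  where "radial f \<longleftrightarrow> (\<exists>\<phi>. \<forall>x. f x = \<phi> (norm x))"

definition outer_product :: "real^'n::finite \<Rightarrow> real^'m::finite \<Rightarrow> real^'m^'n"
  where "outer_product v w = (\<chi> i j. v $ i * w $ j)"

text \<open>The integral is the Bochner integral with values in the space of matrices. The integrand
  at \<open>h = 0\<close> is \<open>0\<close> by the convention \<open>x / 0 = 0\<close>, which is irrelevant since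
  \<open>{0}\<close> is a null set.\<close>

definition nonlocal_Hessian ::
    "(real^'n::finite \<Rightarrow> real) \<Rightarrow> (real^'n \<Rightarrow> real) \<Rightarrow> real^'n \<Rightarrow> real^'n^'n"
  where "nonlocal_Hessian \<rho> u x =
    (real CARD('n) * (real CARD('n) + 2) / 2) *\<^sub>R
      (LINT h|lebesgue.
        (((u (x + h) - 2 * u x + u (x - h)) / (norm h)\<^sup>2) * \<rho> h) *\<^sub>R
        ((1 / (norm h)\<^sup>2) *\<^sub>R
          (outer_product h h - ((norm h)\<^sup>2 / (real CARD('n) + 2)) *\<^sub>R mat 1)))"


section \<open>$L^p$ spaces for $1 \le p \le \infty$\<close>

text \<open>The norm on \<open>real^'n^'n\<close> is the Frobenius norm. The inner case distinction
  extends the \<open>p\<close>-th root to \<open>\<infinity>\<close>, as there is no \<open>powr\<close> on \<open>ennreal\<close>.\<close>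

definition Lp_norm ::
    "ennreal \<Rightarrow> 'a measure \<Rightarrow> ('a \<Rightarrow> 'b::real_normed_vector) \<Rightarrow> ennreal"
  where "Lp_norm p M f =
    (if p = \<infinity> then esssup M (\<lambda>x. ennreal (norm (f x)))
     else let I = (\<integral>\<^sup>+x. ennreal (norm (f x) powr enn2real p) \<partial>M)
          in if I = \<infinity> then \<infinity> else ennreal (enn2real I powr (1 / enn2real p)))"

definition Lp_space ::
    "ennreal \<Rightarrow> 'a measure \<Rightarrow> ('a \<Rightarrow> 'b::real_normed_vector) set"
  where "Lp_space p M = {f \<in> borel_measurable M. Lp_norm p M f < \<infinity>}"

definition tendsto_Lp ::
    "ennreal \<Rightarrow> 'a measure \<Rightarrow> (nat \<Rightarrow> 'a \<Rightarrow> 'b::real_normed_vector) \<Rightarrow> ('a \<Rightarrow> 'b) \<Rightarrow> bool"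
  where "tendsto_Lp p M F f \<longleftrightarrow>
    (\<forall>n. F n \<in> Lp_space p M) \<and> f \<in> Lp_space p M \<and>
    (\<lambda>n. Lp_norm p M (\<lambda>x. F n x - f x)) \<longlonglongrightarrow> 0"

end

theory Submission
  imports Defs
begin

text \<open>
  Write \<open>\<sigma> = h / \<bar>h\<bar>\<close>, \<open>A\<close> for the Hessian of \<open>u\<close> and \<open>N\<close> for the dimension. By Taylor's theorem the
  second difference quotient
  \<open>(u (x + h) - 2 u x + u (x - h)) / \<bar>h\<bar>\<^sup>2\<close> is \<open>\<sigma> \<bullet> A(x) \<sigma>\<close> up to an error \<open>e(x, h)\<close>.

  The main term is reproduced exactly. As \<open>\<rho>\<close> is radial and Lebesgue measure is invariant under
  orthogonal maps, the fourth moments of \<open>\<sigma>\<close> form the isotropic tensor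
  \<open>(\<delta>\<^sub>i\<^sub>j \<delta>\<^sub>k\<^sub>l + \<delta>\<^sub>i\<^sub>k \<delta>\<^sub>j\<^sub>l + \<delta>\<^sub>i\<^sub>l \<delta>\<^sub>j\<^sub>k) / (N (N + 2))\<close> (\<open>angular_moment_eq\<close>). Averaging
  \<open>\<sigma> \<bullet> A \<sigma>\<close> against the trace-corrected kernel \<open>\<sigma> \<otimes> \<sigma> - I / (N + 2)\<close> and multiplying by
  \<open>N (N + 2) / 2\<close> gives back \<open>A\<close>, for every symmetric \<open>A\<close> (\<open>angular_average_quad\<close>); the Hessian is
  symmetric by Schwarz's theorem (\<open>partial_commute\<close>). So the non-local Hessian differs from \<open>A\<close>
  only by the weighted average of \<open>e\<close> (\<open>nonlocal_Hessian_minus_Hessian\<close>).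

  The error is estimated in the two extreme norms at once (\<open>taylor_error_bounds\<close>). For short steps \<open>h\<close>
  it is uniformly small by uniform continuity of the compactly supported Hessian, and lives on a fixed
  bounded set, hence is small in \<open>L\<^sup>1\<close> as well. For \<open>\<bar>h\<bar> > \<delta>\<close> it is bounded, in both norms, by a
  constant depending on \<open>\<delta>\<close>, and the mass of \<open>\<rho> n\<close> there tends to \<open>0\<close>. So the non-local
  Hessians converge uniformly and in \<open>L\<^sup>1\<close> (\<open>nonlocal_Hessian_error\<close>), which is enough for all
  exponents between (\<open>tendsto_Lp_uniform_L1\<close>). Treating \<open>L\<^sup>1\<close> separately is necessary, since the
  kernels may have unbounded support, so that the non-local Hessians need not have compact support.
\<close>

section \<open>Convergence in all $L^p$ from uniform and $L^1$ convergence\<close>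

text \<open>Pointwise form of \<open>\<integral>\<bar>f\<bar>\<^sup>p \<le> \<parallel>f\<parallel>\<^sub>\<infinity>\<^bsup>p-1\<^esup> \<parallel>f\<parallel>\<^sub>1\<close>. The exponent is kept at \<open>p\<close> instead of
  \<open>p - 1\<close>, at the price of \<open>B \<ge> 1\<close>: for \<open>p = 1\<close> the factor \<open>B powr 0\<close> would be \<open>0\<close> at
  \<open>B = 0\<close>, and only the case \<open>B = 1\<close> and finiteness matter below.\<close>

lemma powr_enn2real_le:
  fixes t B :: real and p :: ennreal
  assumes "1 \<le> p" "p \<noteq> \<infinity>" "0 \<le> t" "t \<le> B" "1 \<le> B"
  shows "t powr enn2real p \<le> B powr enn2real p * t"
proof (cases "t = 0")
  case False
  have r: "1 \<le> enn2real p"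
    using assms enn2real_mono[of 1 p] by (simp add: less_top)
  have "t powr enn2real p = t powr (enn2real p - 1) * t"
    using False assms by (simp add: powr_diff)
  also have "\<dots> \<le> B powr (enn2real p - 1) * t"
    using assms r by (intro mult_right_mono powr_mono2) auto
  also have "\<dots> \<le> B powr enn2real p * t"
    using assms by (intro mult_right_mono powr_mono) auto
  finally show ?thesis .
qed simp

lemma bounded_integrable_in_Lp_space:
  fixes f :: "'a \<Rightarrow> 'b::{banach, second_countable_topology}"
  assumes f: "integrable M f" and "bounded (range f)" and p: "1 \<le> p"
  shows "f \<in> Lp_space p M"
proof -
  obtain B0 where B0: "norm (f x) \<le> B0" for x
    using \<open>bounded (range f)\<close> by (auto simp: bounded_iff)
  define B where "B = max 1 B0"
  have B: "norm (f x) \<le> B" "1 \<le> B" for x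
    using B0[of x] by (auto simp: B_def)
  have [measurable]: "f \<in> borel_measurable M"
    using f by simp
  have "Lp_norm p M f < \<infinity>"
  proof (cases "p = \<infinity>")
    case True
    have "esssup M (\<lambda>x. ennreal (norm (f x))) \<le> ennreal B"
      using B by (intro esssup_I) (auto intro!: AE_I2 ennreal_leI)
    then show ?thesis
      using True by (auto simp: Lp_norm_def intro: le_less_trans)
  next
    case False
    have "(\<integral>\<^sup>+x. ennreal (norm (f x) powr enn2real p) \<partial>M)
        \<le> (\<integral>\<^sup>+x. ennreal (B powr enn2real p) * ennreal (norm (f x)) \<partial>M)"
      using powr_enn2real_le[OF p False norm_ge_zero B]
      by (intro nn_integral_mono) (simp add: ennreal_leI flip: ennreal_mult)
    also have "\<dots> = ennreal (B powr enn2real p) * (\<integral>\<^sup>+x. ennreal (norm (f x)) \<partial>M)"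
      by (rule nn_integral_cmult) simp
    also have "\<dots> < \<infinity>"
      using f by (auto simp: integrable_iff_bounded ennreal_mult_less_top)
    finally show ?thesis
      using False by (auto simp: Lp_norm_def Let_def)
  qed
  then show ?thesis
    by (simp add: Lp_space_def)
qed

text \<open>The two endpoints of the scale control all of it: once \<open>\<bar>F n - f\<bar> \<le> 1\<close> everywhere,
  its \<open>p\<close>-th power is below its first power, so the \<open>p\<close>-norm is at most the \<open>1/p\<close>-th power of the
  \<open>L\<^sup>1\<close>-distance.\<close>

lemma tendsto_Lp_uniform_L1:
  fixes F :: "nat \<Rightarrow> 'a \<Rightarrow> 'b::{banach, second_countable_topology}"
  assumes F: "\<And>n. integrable M (F n)" "\<And>n. bounded (range (F n))"
    and f: "integrable M f" "bounded (range f)"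
    and unif: "uniform_limit UNIV F f sequentially"
    and L1: "(\<lambda>n. LINT x|M. norm (F n x - f x)) \<longlonglongrightarrow> 0"
    and p: "1 \<le> p"
  shows "tendsto_Lp p M F f"
proof -
  have [measurable]: "\<And>n. F n \<in> borel_measurable M" "f \<in> borel_measurable M"
    using F f by auto
  have "(\<lambda>n. Lp_norm p M (\<lambda>x. F n x - f x)) \<longlonglongrightarrow> 0"
  proof (cases "p = \<infinity>")
    case True
    show ?thesis
    proof (rule tendsto_zero_ennreal)
      fix e :: real assume "0 < e"
      with unif have "\<forall>\<^sub>F n in sequentially. \<forall>x\<in>UNIV. dist (F n x) (f x) < e / 2"
        by (intro uniform_limitD) auto
      then show "\<forall>\<^sub>F n in sequentially. Lp_norm p M (\<lambda>x. F n x - f x) < ennreal e"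
      proof eventually_elim
        case (elim n)
        then have "esssup M (\<lambda>x. ennreal (norm (F n x - f x))) \<le> ennreal (e / 2)"
          by (intro esssup_I AE_I2 ennreal_leI) (simp_all add: dist_norm less_imp_le)
        also have "ennreal (e / 2) < ennreal e"
          using \<open>0 < e\<close> by (intro ennreal_lessI) auto
        finally show ?case
          using True by (simp add: Lp_norm_def)
      qed
    qed
  next
    case False
    define r where "r = enn2real p"
    have r: "r > 0"
      using False p enn2real_mono[of 1 p] by (simp add: less_top r_def)
    let ?D = "\<lambda>n. LINT x|M. norm (F n x - f x)"
    have "(\<lambda>n. ennreal (?D n powr (1 / r))) \<longlonglongrightarrow> ennreal (0 powr (1 / r))"
      using r by (intro tendsto_ennrealI tendsto_powr'[OF L1 tendsto_const]) auto
    then have lim: "(\<lambda>n. ennreal (?D n powr (1 / r))) \<longlonglongrightarrow> 0"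
      by simp
    have "\<forall>\<^sub>F n in sequentially. \<forall>x\<in>UNIV. dist (F n x) (f x) < 1"
      using unif by (rule uniform_limitD) simp
    then have "\<forall>\<^sub>F n in sequentially. Lp_norm p M (\<lambda>x. F n x - f x) \<le> ennreal (?D n powr (1 / r))"
    proof eventually_elim
      case (elim n)
      let ?I = "\<integral>\<^sup>+x. ennreal (norm (F n x - f x) powr r) \<partial>M"
      have "norm (F n x - f x) powr r \<le> norm (F n x - f x)" for x
      proof -
        have "norm (F n x - f x) \<le> 1"
          using elim by (simp add: dist_norm less_imp_le)
        then show ?thesis
          using powr_enn2real_le[OF p False norm_ge_zero _ order_refl] by (simp add: r_def)
      qed
      then have "?I \<le> (\<integral>\<^sup>+x. ennreal (norm (F n x - f x)) \<partial>M)"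
        by (intro nn_integral_mono ennreal_leI)
      also have "\<dots> = ennreal (?D n)"
        using F f by (intro nn_integral_eq_integral) auto
      finally have I: "?I \<le> ennreal (?D n)" .
      have "0 \<le> ?D n"
        by simp
      then have "enn2real ?I \<le> ?D n"
        using enn2real_mono[OF I] by simp
      then have "enn2real ?I powr (1 / r) \<le> ?D n powr (1 / r)"
        using r by (intro powr_mono2) auto
      moreover have "?I \<noteq> \<infinity>"
        using I by (auto simp: top_unique)
      ultimately show ?case
        using False by (simp add: Lp_norm_def Let_def r_def ennreal_leI)
    qed
    then show ?thesis
      by (rule tendsto_sandwich[OF _ _ tendsto_const lim, rotated]) simp
  qed
  then show ?thesis
    using F f p by (simp add: tendsto_Lp_def bounded_integrable_in_Lp_space)
qed

section \<open>Invariance of Lebesgue measure under orthogonal maps\<close>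

lemma borel_measurable_orthogonal:
  fixes P :: "'a::euclidean_space \<Rightarrow> 'a"
  assumes "orthogonal_transformation P"
  shows "P \<in> borel_measurable borel"
  using assms by (intro borel_measurable_continuous_onI linear_continuous_on)
    (simp add: orthogonal_transformation_def linear_conv_bounded_linear)

text \<open>Uniqueness of Haar measure, carried out for this one map. Average the left side over all
  translates by \<open>z\<close> in the unit ball, each of which leaves it unchanged since \<open>P\<close> is onto, and
  exchange the integrals: the weight that \<open>f w\<close> receives is the volume of
  \<open>{x. \<bar>w - P x\<bar> < 1}\<close>, which is again a unit ball because \<open>P\<close> is an isometry.\<close>

lemma nn_integral_lborel_orthogonal:
  fixes P :: "real^'n::finite \<Rightarrow> real^'n"
  assumes P: "orthogonal_transformation P" and [measurable]: "f \<in> borel_measurable borel"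
  shows "(\<integral>\<^sup>+x. f (P x) \<partial>lborel) = (\<integral>\<^sup>+x. f x \<partial>lborel)"
proof -
  have "linear P"
    using P by (simp add: orthogonal_transformation_def)
  note borel_measurable_orthogonal[OF P, measurable]
  have [measurable]: "ball (0::real^'n) 1 \<in> sets borel"
    by simp
  define V where "V = emeasure lborel (ball (0::real^'n) 1)"
  have V_ball: "emeasure lborel (ball c 1) = V" for c :: "real^'n"
    unfolding V_def by (simp add: emeasure_ball)
  have V: "V \<noteq> 0" "V \<noteq> \<infinity>"
  proof -
    show "V \<noteq> 0"
      using content_ball_pos[of 1 "0::real^'n"] by (auto simp: V_def measure_def)
    show "V \<noteq> \<infinity>"
      unfolding V_def using emeasure_lborel_ball_finite[of "0::real^'n" 1] by auto
  qed
  have shift: "(\<integral>\<^sup>+x. f (P x + z) \<partial>lborel) = (\<integral>\<^sup>+x. f (P x) \<partial>lborel)" for z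
  proof -
    obtain z' where z: "P z' = z"
      using orthogonal_transformation_surj[OF P] by (metis surjD)
    have "(\<integral>\<^sup>+x. f (P x) \<partial>lborel) = (\<integral>\<^sup>+x. f (P x) \<partial>distr lborel borel ((+) z'))"
      by (simp add: lborel_distr_plus)
    also have "\<dots> = (\<integral>\<^sup>+x. f (P x + z) \<partial>lborel)"
      by (subst nn_integral_distr) (auto simp: linear_add[OF \<open>linear P\<close>] z add.commute)
    finally show ?thesis ..
  qed
  have "(\<integral>\<^sup>+x. f (P x) \<partial>lborel) * V = (\<integral>\<^sup>+z. (\<integral>\<^sup>+x. f (P x) \<partial>lborel) * indicator (ball (0::real^'n) 1) z \<partial>lborel)"
    unfolding V_def by (subst nn_integral_cmult_indicator) auto
  also have "\<dots> = (\<integral>\<^sup>+z. (\<integral>\<^sup>+x. f (P x + z) * indicator (ball 0 1) z \<partial>lborel) \<partial>lborel)"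
    by (simp add: nn_integral_multc shift)
  also have "\<dots> = (\<integral>\<^sup>+x. (\<integral>\<^sup>+z. f (P x + z) * indicator (ball 0 1) z \<partial>lborel) \<partial>lborel)"
    by (rule lborel_pair.Fubini') measurable
  also have "\<dots> = (\<integral>\<^sup>+x. (\<integral>\<^sup>+w. f w * indicator (ball 0 1) (w - P x) \<partial>lborel) \<partial>lborel)"
  proof (rule nn_integral_cong)
    fix x
    have "(\<integral>\<^sup>+w. f w * indicator (ball 0 1) (w - P x) \<partial>lborel)
        = (\<integral>\<^sup>+w. f w * indicator (ball 0 1) (w - P x) \<partial>distr lborel borel ((+) (P x)))"
      by (simp add: lborel_distr_plus)
    also have "\<dots> = (\<integral>\<^sup>+z. f (P x + z) * indicator (ball 0 1) z \<partial>lborel)"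
      by (subst nn_integral_distr) auto
    finally show "(\<integral>\<^sup>+z. f (P x + z) * indicator (ball 0 1) z \<partial>lborel)
        = (\<integral>\<^sup>+w. f w * indicator (ball 0 1) (w - P x) \<partial>lborel)" ..
  qed
  also have "\<dots> = (\<integral>\<^sup>+w. (\<integral>\<^sup>+x. f w * indicator (ball 0 1) (w - P x) \<partial>lborel) \<partial>lborel)"
    by (rule lborel_pair.Fubini') measurable
  also have "\<dots> = (\<integral>\<^sup>+w. f w * V \<partial>lborel)"
  proof (rule nn_integral_cong)
    fix w
    obtain w' where w: "P w' = w"
      using orthogonal_transformation_surj[OF P] by (metis surjD)
    have "norm (w - P x) = dist w' x" for x
      using P orthogonal_transformation_isometry[of P] by (metis w dist_norm)
    then have "(\<integral>\<^sup>+x. f w * indicator (ball 0 1) (w - P x) \<partial>lborel)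
        = (\<integral>\<^sup>+x. f w * indicator (ball w' 1) x \<partial>lborel)"
      by (intro nn_integral_cong) (simp add: indicator_def)
    also have "\<dots> = f w * V"
      by (subst nn_integral_cmult_indicator) (auto simp: V_ball)
    finally show "(\<integral>\<^sup>+x. f w * indicator (ball 0 1) (w - P x) \<partial>lborel) = f w * V" .
  qed
  also have "\<dots> = (\<integral>\<^sup>+x. f x \<partial>lborel) * V"
    by (rule nn_integral_multc) simp
  finally show ?thesis
    using V by (metis infinity_ennreal_def mult.commute ennreal_mult_cancel_left)
qed

text \<open>A radial density is only assumed to be Lebesgue measurable, and its Borel versions need
  not be radial. Hence the invariance is lifted to the completed measure.\<close>

lemma lebesgue_distr_orthogonal:
  fixes P :: "real^'n::finite \<Rightarrow> real^'n"
  assumes P: "orthogonal_transformation P"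
  shows "distr lebesgue lebesgue P = lebesgue" "P \<in> lebesgue \<rightarrow>\<^sub>M lebesgue"
proof -
  note borel_measurable_orthogonal[OF P, measurable]
  have lborel: "distr lborel borel P = lborel"
  proof (rule measure_eqI)
    fix A :: "(real^'n) set" assume "A \<in> sets (distr lborel borel P)"
    then have [measurable]: "A \<in> sets borel"
      by simp
    have "emeasure (distr lborel borel P) A = (\<integral>\<^sup>+x. indicator A x \<partial>distr lborel borel P)"
      by simp
    also have "\<dots> = (\<integral>\<^sup>+x. indicator A (P x) \<partial>lborel)"
      by (subst nn_integral_distr) auto
    also have "\<dots> = emeasure lborel A"
      by (subst nn_integral_lborel_orthogonal[OF P]) auto
    finally show "emeasure (distr lborel borel P) A = emeasure lborel A" .
  qed simp
  have null: "null_sets (distr lebesgue lborel P) = null_sets lborel"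
    and eq: "distr lebesgue lborel P = lborel"
  proof -
    have "distr lebesgue lborel P = distr lborel borel P"
    proof (rule measure_eqI)
      fix A assume "A \<in> sets (distr lebesgue lborel P)"
      then have [measurable]: "A \<in> sets borel"
        by simp
      have "P -` A \<in> sets lborel"
        using measurable_sets[of P borel borel A] by simp
      then show "emeasure (distr lebesgue lborel P) A = emeasure (distr lborel borel P) A"
        by (simp add: emeasure_distr measurable_completion)
    qed simp
    then show "distr lebesgue lborel P = lborel"
      by (simp add: lborel)
    then show "null_sets (distr lebesgue lborel P) = null_sets lborel"
      by simp
  qed
  have m: "P \<in> lebesgue \<rightarrow>\<^sub>M lborel"
    by (rule measurable_completion) simp
  show "distr lebesgue lebesgue P = lebesgue"
    using completion.completion_distr_eq[OF m null] by (simp add: eq)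
  show "P \<in> lebesgue \<rightarrow>\<^sub>M lebesgue"
    by (rule completion.measurable_completion2[OF m]) (simp add: null)
qed

lemma integral_lebesgue_orthogonal:
  fixes P :: "real^'n::finite \<Rightarrow> real^'n" and f :: "real^'n \<Rightarrow> real"
  assumes "orthogonal_transformation P" and f: "f \<in> borel_measurable lebesgue"
  shows "(LINT x|lebesgue. f (P x)) = (LINT x|lebesgue. f x)"
  using integral_distr[OF lebesgue_distr_orthogonal(2)[OF assms(1)] f]
  by (simp add: lebesgue_distr_orthogonal[OF assms(1)])

section \<open>Fourth angular moments of a radial density\<close>

text \<open>The direction of \<open>h\<close> is \<open>sgn h\<close>, with \<open>sgn 0 = 0\<close>. Taking vectors as arguments, in place of four
  coordinate indices, makes the moment a symmetric form that can be polarised.\<close>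

definition angular_moment ::
    "(real^'n::finite \<Rightarrow> real) \<Rightarrow> real^'n \<Rightarrow> real^'n \<Rightarrow> real^'n \<Rightarrow> real^'n \<Rightarrow> real"
  where "angular_moment \<rho> a b c d =
    (LINT h|lebesgue. \<rho> h * ((sgn h \<bullet> a) * (sgn h \<bullet> b) * (sgn h \<bullet> c) * (sgn h \<bullet> d)))"

lemma abs_sgn_inner_le: "\<bar>sgn h \<bullet> a\<bar> \<le> norm a"
  using Cauchy_Schwarz_ineq2[of "sgn h" a] by (auto simp: norm_sgn split: if_splits)

lemma integrable_bounded_mult:
  fixes \<rho> :: "real^'n::finite \<Rightarrow> real" and K :: "real^'n \<Rightarrow> 'b::{banach, second_countable_topology}"
  assumes \<rho>: "integrable lebesgue \<rho>" and K: "K \<in> borel_measurable borel" and bound: "\<And>h. norm (K h) \<le> c"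
  shows "integrable lebesgue (\<lambda>h. \<rho> h *\<^sub>R K h)"
proof (rule Bochner_Integration.integrable_bound)
  show "integrable lebesgue (\<lambda>h. c * \<rho> h)"
    using \<rho> by simp
  have [measurable]: "\<rho> \<in> borel_measurable lebesgue" "K \<in> borel_measurable lebesgue"
    using \<rho> K by (auto intro: measurable_completion)
  show "(\<lambda>h. \<rho> h *\<^sub>R K h) \<in> borel_measurable lebesgue"
    by measurable
  show "AE h in lebesgue. norm (\<rho> h *\<^sub>R K h) \<le> norm (c * \<rho> h)"
  proof (rule AE_I2)
    fix h
    have "0 \<le> c"
      by (rule order_trans[OF norm_ge_zero bound])
    then show "norm (\<rho> h *\<^sub>R K h) \<le> norm (c * \<rho> h)"
      using mult_right_mono[OF bound[of h], of "\<bar>\<rho> h\<bar>"] by (simp add: abs_mult mult.commute)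
  qed
qed

lemma integrable_angular_moment:
  fixes \<rho> :: "real^'n::finite \<Rightarrow> real"
  assumes \<rho>: "integrable lebesgue \<rho>"
  shows "integrable lebesgue
    (\<lambda>h. \<rho> h * ((sgn h \<bullet> a) * (sgn h \<bullet> b) * (sgn h \<bullet> c) * (sgn h \<bullet> d)))"
proof -
  let ?K = "\<lambda>h. (sgn h \<bullet> a) * (sgn h \<bullet> b) * (sgn h \<bullet> c) * (sgn h \<bullet> d)"
  have "norm (?K h) \<le> norm a * norm b * norm c * norm d" for h
    unfolding real_norm_def abs_mult by (intro mult_mono abs_sgn_inner_le mult_nonneg_nonneg) auto
  from integrable_bounded_mult[OF \<rho> _ this] show ?thesis
    by simp
qed

lemma angular_moment_swap:
  "angular_moment \<rho> b a c d = angular_moment \<rho> a b c d"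
  "angular_moment \<rho> a c b d = angular_moment \<rho> a b c d"
  "angular_moment \<rho> a b d c = angular_moment \<rho> a b c d"
  "angular_moment \<rho> c b a d = angular_moment \<rho> a b c d"
  "angular_moment \<rho> d b c a = angular_moment \<rho> a b c d"
  by (simp_all add: angular_moment_def ac_simps)

lemma angular_moment_add:
  assumes "integrable lebesgue \<rho>"
  shows "angular_moment \<rho> (a + a') b c d = angular_moment \<rho> a b c d + angular_moment \<rho> a' b c d"
proof -
  note int = integrable_angular_moment[OF assms]
  show ?thesis
    unfolding angular_moment_def
    by (subst Bochner_Integration.integral_add[OF int int, symmetric])
       (simp add: algebra_simps)
qed

lemma angular_moment_scaleR:
  "angular_moment \<rho> (r *\<^sub>R a) (r *\<^sub>R b) (r *\<^sub>R c) (r *\<^sub>R d) = r ^ 4 * angular_moment \<rho> a b c d"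
  unfolding angular_moment_def
  by (subst Bochner_Integration.integral_mult_right_zero[symmetric])
     (simp add: power4_eq_xxxx ac_simps)

lemma angular_moment_linear:
  assumes "integrable lebesgue \<rho>"
  shows "angular_moment \<rho> (a + a') b c d = angular_moment \<rho> a b c d + angular_moment \<rho> a' b c d"
    and "angular_moment \<rho> a (b + b') c d = angular_moment \<rho> a b c d + angular_moment \<rho> a b' c d"
    and "angular_moment \<rho> a b (c + c') d = angular_moment \<rho> a b c d + angular_moment \<rho> a b c' d"
    and "angular_moment \<rho> a b c (d + d') = angular_moment \<rho> a b c d + angular_moment \<rho> a b c d'"
    and "angular_moment \<rho> (a - a') b c d = angular_moment \<rho> a b c d - angular_moment \<rho> a' b c d"
    and "angular_moment \<rho> a (b - b') c d = angular_moment \<rho> a b c d - angular_moment \<rho> a b' c d"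
    and "angular_moment \<rho> a b (c - c') d = angular_moment \<rho> a b c d - angular_moment \<rho> a b c' d"
    and "angular_moment \<rho> a b c (d - d') = angular_moment \<rho> a b c d - angular_moment \<rho> a b c d'"
proof -
  note add = angular_moment_add[OF assms]
  have diff: "angular_moment \<rho> (a - a') b c d = angular_moment \<rho> a b c d - angular_moment \<rho> a' b c d"
    for a a' b c d
    using add[of "a - a'" a' b c d] by simp
  show "angular_moment \<rho> (a + a') b c d = angular_moment \<rho> a b c d + angular_moment \<rho> a' b c d"
    by (rule add)
  show "angular_moment \<rho> a (b + b') c d = angular_moment \<rho> a b c d + angular_moment \<rho> a b' c d"
    by (metis add angular_moment_swap(1))
  show "angular_moment \<rho> a b (c + c') d = angular_moment \<rho> a b c d + angular_moment \<rho> a b c' d"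
    by (metis add angular_moment_swap(4))
  show "angular_moment \<rho> a b c (d + d') = angular_moment \<rho> a b c d + angular_moment \<rho> a b c d'"
    by (metis add angular_moment_swap(5))
  show "angular_moment \<rho> (a - a') b c d = angular_moment \<rho> a b c d - angular_moment \<rho> a' b c d"
    by (rule diff)
  show "angular_moment \<rho> a (b - b') c d = angular_moment \<rho> a b c d - angular_moment \<rho> a b' c d"
    by (metis diff angular_moment_swap(1))
  show "angular_moment \<rho> a b (c - c') d = angular_moment \<rho> a b c d - angular_moment \<rho> a b c' d"
    by (metis diff angular_moment_swap(4))
  show "angular_moment \<rho> a b c (d - d') = angular_moment \<rho> a b c d - angular_moment \<rho> a b c d'"
    by (metis diff angular_moment_swap(5))
qed

text \<open>Substituting \<open>P h\<close> for \<open>h\<close> preserves the measure and \<open>\<rho>\<close>, and moves \<open>P\<close> from the vectors to \<open>h\<close>.\<close>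

lemma angular_moment_orthogonal:
  fixes \<rho> :: "real^'n::finite \<Rightarrow> real"
  assumes "radial \<rho>" and \<rho>: "integrable lebesgue \<rho>" and P: "orthogonal_transformation P"
  shows "angular_moment \<rho> (P a) (P b) (P c) (P d) = angular_moment \<rho> a b c d"
proof -
  from \<open>radial \<rho>\<close> obtain \<phi> where \<phi>: "\<rho> x = \<phi> (norm x)" for x
    by (auto simp: radial_def)
  have norm_P: "norm (P h) = norm h" for h
    using P by (simp add: orthogonal_transformation)
  then have \<rho>_P: "\<rho> (P h) = \<rho> h" for h
    by (simp add: \<phi>)
  have "linear P" and inner_P: "P v \<bullet> P w = v \<bullet> w" for v w
    using P by (auto simp: orthogonal_transformation_def)
  then have sgn_P: "sgn (P h) = P (sgn h)" for h
    by (simp add: sgn_div_norm norm_P linear_scale)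
  have "angular_moment \<rho> (P a) (P b) (P c) (P d) =
      (LINT h|lebesgue. \<rho> (P h) * ((sgn (P h) \<bullet> P a) * (sgn (P h) \<bullet> P b) * (sgn (P h) \<bullet> P c) * (sgn (P h) \<bullet> P d)))"
    unfolding angular_moment_def
    by (rule integral_lebesgue_orthogonal[OF P, symmetric])
       (use integrable_angular_moment[OF \<rho>] in auto)
  then show ?thesis
    by (simp add: \<rho>_P sgn_P inner_P angular_moment_def)
qed

text \<open>Contracting two of the four slots gives \<open>\<bar>sgn h\<bar>\<^sup>2\<close>, that is \<open>1\<close>, except at \<open>h = 0\<close> where
  both sides vanish. Second moments are thus contractions of fourth moments.\<close>

lemma sum_angular_axis:
  fixes h :: "real^'n::finite"
  shows "(\<Sum>i\<in>UNIV. r * ((sgn h \<bullet> a) * (sgn h \<bullet> b) * (sgn h \<bullet> axis i 1) * (sgn h \<bullet> axis i 1)))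
    = r * ((sgn h \<bullet> a) * (sgn h \<bullet> b))"
proof -
  have "(\<Sum>i\<in>UNIV. r * ((sgn h \<bullet> a) * (sgn h \<bullet> b) * (sgn h \<bullet> axis i 1) * (sgn h \<bullet> axis i 1)))
      = r * ((sgn h \<bullet> a) * (sgn h \<bullet> b)) * (sgn h \<bullet> sgn h)"
    by (simp add: inner_axis inner_vec_def[of "sgn h" "sgn h"] sum_distrib_left mult.assoc)
  also have "\<dots> = r * ((sgn h \<bullet> a) * (sgn h \<bullet> b))"
    by (cases "h = 0") (auto simp: norm_sgn simp flip: power2_norm_eq_inner)
  finally show ?thesis .
qed

lemma sum_angular_moment_axis:
  fixes \<rho> :: "real^'n::finite \<Rightarrow> real"
  assumes \<rho>: "integrable lebesgue \<rho>"
  shows "(\<Sum>i\<in>UNIV. angular_moment \<rho> a b (axis i 1) (axis i 1)) =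
      (LINT h|lebesgue. \<rho> h * ((sgn h \<bullet> a) * (sgn h \<bullet> b)))"
  unfolding angular_moment_def
  by (subst Bochner_Integration.integral_sum[symmetric])
     (simp_all only: sum_angular_axis integrable_angular_moment[OF \<rho>])

lemma integrable_angular_moment2:
  fixes \<rho> :: "real^'n::finite \<Rightarrow> real"
  assumes \<rho>: "integrable lebesgue \<rho>"
  shows "integrable lebesgue (\<lambda>h. \<rho> h * ((sgn h \<bullet> a) * (sgn h \<bullet> b)))"
  by (subst sum_angular_axis[symmetric])
     (intro Bochner_Integration.integrable_sum integrable_angular_moment[OF \<rho>])

text \<open>On the diagonal the form is a quartic in one vector that depends on its length only, since
  orthogonal maps act transitively on spheres. A symmetric 4-linear form is determined by its
  diagonal; polarising three times recovers it, and the same polarisation turns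
  \<open>3 \<kappa> \<bar>v\<bar>\<^sup>4\<close> into the isotropic tensor.\<close>

lemma angular_moment_isotropic:
  fixes \<rho> :: "real^'n::finite \<Rightarrow> real"
  assumes rad: "radial \<rho>" and \<rho>: "integrable lebesgue \<rho>"
  obtains \<kappa> where "\<And>a b c d. angular_moment \<rho> a b c d =
      \<kappa> * ((a \<bullet> b) * (c \<bullet> d) + (a \<bullet> c) * (b \<bullet> d) + (a \<bullet> d) * (b \<bullet> c))"
proof -
  let ?M = "angular_moment \<rho>"
  note lin = angular_moment_linear[OF \<rho>]
  obtain e :: "real^'n" where e: "norm e = 1"
    using vector_choose_size[of 1] by auto
  define \<kappa> where "\<kappa> = ?M e e e e / 3"
  have diag: "?M v v v v = 3 * \<kappa> * (v \<bullet> v)\<^sup>2" for v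
  proof -
    have "norm (norm v *\<^sub>R e) = norm v"
      using e by simp
    then obtain P where P: "orthogonal_transformation P" "P (norm v *\<^sub>R e) = v"
      by (rule orthogonal_transformation_exists)
    have "?M v v v v = ?M (norm v *\<^sub>R e) (norm v *\<^sub>R e) (norm v *\<^sub>R e) (norm v *\<^sub>R e)"
      using angular_moment_orthogonal[OF rad \<rho> P(1)] P(2) by metis
    also have "\<dots> = norm v ^ 4 * ?M e e e e"
      by (rule angular_moment_scaleR)
    also have "\<dots> = 3 * \<kappa> * (v \<bullet> v)\<^sup>2"
      by (simp add: \<kappa>_def flip: power2_norm_eq_inner power_mult)
    finally show ?thesis .
  qed
  have two: "?M v v w w = \<kappa> * ((v \<bullet> v) * (w \<bullet> w) + 2 * (v \<bullet> w)\<^sup>2)" for v w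
  proof -
    \<comment> \<open>Add the expansions of \<open>(v + w)\<^sup>4\<close> and \<open>(v - w)\<^sup>4\<close>: odd terms cancel, \<open>6 + 6\<close> mixed ones stay.\<close>
    have "12 * ?M v v w w =
        ?M (v + w) (v + w) (v + w) (v + w) + ?M (v - w) (v - w) (v - w) (v - w)
        - 2 * ?M v v v v - 2 * ?M w w w w"
      by (simp add: lin angular_moment_swap(1-3))
    also have "\<dots> = 12 * (\<kappa> * ((v \<bullet> v) * (w \<bullet> w) + 2 * (v \<bullet> w)\<^sup>2))"
      unfolding diag
      by (simp add: inner_simps inner_commute[of w v] power2_eq_square algebra_simps)
    finally show ?thesis
      by simp
  qed
  have three: "?M a b w w = \<kappa> * ((a \<bullet> b) * (w \<bullet> w) + 2 * (a \<bullet> w) * (b \<bullet> w))" for a b w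
  proof -
    have "4 * ?M a b w w = ?M (a + b) (a + b) w w - ?M (a - b) (a - b) w w"
      by (simp add: lin angular_moment_swap(1-3))
    also have "\<dots> = 4 * (\<kappa> * ((a \<bullet> b) * (w \<bullet> w) + 2 * (a \<bullet> w) * (b \<bullet> w)))"
      unfolding two
      by (simp add: inner_simps inner_commute[of b a] power2_eq_square algebra_simps)
    finally show ?thesis
      by simp
  qed
  have "?M a b c d = \<kappa> * ((a \<bullet> b) * (c \<bullet> d) + (a \<bullet> c) * (b \<bullet> d) + (a \<bullet> d) * (b \<bullet> c))" for a b c d
  proof -
    have "4 * ?M a b c d = ?M a b (c + d) (c + d) - ?M a b (c - d) (c - d)"
      by (simp add: lin angular_moment_swap(1-3))
    also have "\<dots> = 4 * (\<kappa> * ((a \<bullet> b) * (c \<bullet> d) + (a \<bullet> c) * (b \<bullet> d) + (a \<bullet> d) * (b \<bullet> c)))"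
      unfolding three
      by (simp add: inner_simps inner_commute[of d c] power2_eq_square algebra_simps)
    finally show ?thesis
      by simp
  qed
  then show ?thesis
    by (rule that)
qed

text \<open>The constant is found by contracting both pairs of slots: the total mass \<open>1\<close> must equal
  \<open>\<kappa>\<close> times \<open>N * N + 2 * N\<close>.\<close>

lemma angular_moment_eq:
  fixes \<rho> :: "real^'n::finite \<Rightarrow> real"
  assumes rad: "radial \<rho>" and \<rho>: "integrable lebesgue \<rho>" and one: "(LINT h|lebesgue. \<rho> h) = 1"
  shows "angular_moment \<rho> a b c d =
      ((a \<bullet> b) * (c \<bullet> d) + (a \<bullet> c) * (b \<bullet> d) + (a \<bullet> d) * (b \<bullet> c))
      / (real CARD('n) * (real CARD('n) + 2))"
proof -
  let ?N = "real CARD('n)"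
  obtain \<kappa> where \<kappa>: "\<And>a b c d. angular_moment \<rho> a b c d =
      \<kappa> * ((a \<bullet> b) * (c \<bullet> d) + (a \<bullet> c) * (b \<bullet> d) + (a \<bullet> d) * (b \<bullet> c))"
    using angular_moment_isotropic[OF rad \<rho>] by blast
  have "(\<Sum>j\<in>UNIV. \<Sum>i\<in>UNIV. angular_moment \<rho> (axis j 1) (axis j 1) (axis i 1) (axis i 1))
      = (\<Sum>j\<in>UNIV. LINT h|lebesgue. \<rho> h * ((sgn h \<bullet> axis j 1) * (sgn h \<bullet> axis j 1)))"
    by (simp only: sum_angular_moment_axis[OF \<rho>])
  also have "\<dots> = (LINT h|lebesgue. (\<Sum>j\<in>UNIV. \<rho> h * ((sgn h \<bullet> axis j 1) * (sgn h \<bullet> axis j 1))))"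
    by (rule Bochner_Integration.integral_sum[symmetric]) (rule integrable_angular_moment2[OF \<rho>])
  also have "\<dots> = (LINT h|lebesgue. \<rho> h)"
  proof (rule integral_cong_AE)
    have "AE h in lborel. (h::real^'n) \<noteq> 0"
      by (rule AE_lborel_singleton)
    then have "AE h in lebesgue. (h::real^'n) \<noteq> 0"
      by (rule AE_completion)
    then show "AE h in lebesgue. (\<Sum>j\<in>UNIV. \<rho> h * ((sgn h \<bullet> axis j 1) * (sgn h \<bullet> axis j 1))) = \<rho> h"
    proof eventually_elim
      case (elim h)
      have "(\<Sum>j\<in>UNIV. \<rho> h * ((sgn h \<bullet> axis j 1) * (sgn h \<bullet> axis j 1))) = \<rho> h * (sgn h \<bullet> sgn h)"
        by (simp add: inner_axis inner_vec_def[of "sgn h" "sgn h"] sum_distrib_left)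
      then show ?case
        using elim by (auto simp: norm_sgn simp flip: power2_norm_eq_inner)
    qed
  qed (use \<rho> integrable_angular_moment2[OF \<rho>] in auto)
  also have "\<dots> = 1"
    by (rule one)
  finally have "(\<Sum>j\<in>UNIV. \<Sum>i\<in>UNIV. angular_moment \<rho> (axis j 1) (axis j 1) (axis i 1) (axis i 1)) = 1" .
  moreover have "angular_moment \<rho> (axis j 1) (axis j 1) (axis i 1) (axis i 1)
      = \<kappa> * (1 + (if i = j then 2 else 0))" for i j
    unfolding \<kappa> by (simp add: inner_axis_axis)
  moreover have "(\<Sum>j\<in>UNIV. \<Sum>i\<in>UNIV. \<kappa> * (1 + (if (i::'n) = j then 2 else 0)))
      = \<kappa> * (?N * (?N + 2))"
    by (simp add: sum.distrib algebra_simps flip: sum_distrib_left)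
  ultimately have "\<kappa> * (?N * (?N + 2)) = 1"
    by simp
  then have "\<kappa> = 1 / (?N * (?N + 2))"
    by (metis mult_zero_right nonzero_eq_divide_eq zero_neq_one)
  then show ?thesis
    by (simp add: \<kappa>)
qed

section \<open>Second derivatives and second differences\<close>

lemma has_derivative_partial:
  fixes u :: "real^'n::finite \<Rightarrow> real"
  assumes "u differentiable (at x)"
  shows "(u has_derivative (\<lambda>h. \<Sum>i\<in>UNIV. h $ i * partial i u x)) (at x)"
proof -
  let ?D = "frechet_derivative u (at x)"
  have D: "(u has_derivative ?D) (at x)"
    using assms by (simp add: frechet_derivative_works)
  then have "linear ?D"
    by (rule has_derivative_linear)
  have "?D h = (\<Sum>i\<in>UNIV. h $ i * partial i u x)" for h
  proof -
    have "?D h = ?D (\<Sum>i\<in>UNIV. h $ i *\<^sub>R axis i 1)"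
      by (simp add: basis_expansion flip: scalar_mult_eq_scaleR)
    also have "\<dots> = (\<Sum>i\<in>UNIV. h $ i * partial i u x)"
      by (simp add: linear_sum[OF \<open>linear ?D\<close>] linear_scale[OF \<open>linear ?D\<close>] partial_def)
    finally show ?thesis .
  qed
  then have "?D = (\<lambda>h. \<Sum>i\<in>UNIV. h $ i * partial i u x)" ..
  with D show ?thesis
    by simp
qed

lemma has_real_derivative_along_line:
  fixes u :: "real^'n::finite \<Rightarrow> real"
  assumes "\<And>x. u differentiable (at x)"
  shows "((\<lambda>t. u (x + t *\<^sub>R h)) has_real_derivative (\<Sum>i\<in>UNIV. h $ i * partial i u (x + t *\<^sub>R h)))
    (at t within S)"
proof -
  have "((\<lambda>t. u (x + t *\<^sub>R h)) has_derivative
      (\<lambda>s. \<Sum>i\<in>UNIV. (s *\<^sub>R h) $ i * partial i u (x + t *\<^sub>R h))) (at t within S)"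
    by (rule has_derivative_compose[OF _ has_derivative_partial[OF assms], rotated])
       (auto intro!: derivative_eq_intros)
  moreover have "(\<lambda>s. \<Sum>i\<in>UNIV. (s *\<^sub>R h) $ i * partial i u (x + t *\<^sub>R h))
      = (*) (\<Sum>i\<in>UNIV. h $ i * partial i u (x + t *\<^sub>R h))"
    by (simp add: fun_eq_iff sum_distrib_left sum_distrib_right ac_simps)
  ultimately show ?thesis
    by (simp add: has_field_derivative_def)
qed

lemma Ck_2D:
  fixes u :: "real^'n::finite \<Rightarrow> real"
  assumes "Ck 2 u"
  shows "u differentiable (at x)" and "partial i u differentiable (at x)"
    and "continuous_on UNIV (partial j (partial i u))" and "continuous_on UNIV u"
proof -
  have "Ck (Suc (Suc 0)) u"
    using assms by (simp add: numeral_2_eq_2)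
  then show *: "u differentiable (at x)" "partial i u differentiable (at x)"
      "continuous_on UNIV (partial j (partial i u))" for x i j
    by auto
  show "continuous_on UNIV u"
    by (intro differentiable_imp_continuous_on) (simp add: *(1) differentiable_on_def)
qed

lemma has_real_derivative_partial_line:
  fixes u :: "real^'n::finite \<Rightarrow> real"
  assumes "\<And>x. u differentiable (at x)"
  shows "((\<lambda>t. u (x + t *\<^sub>R axis i 1)) has_real_derivative partial i u (x + t *\<^sub>R axis i 1)) (at t)"
proof -
  have "(\<Sum>k\<in>UNIV. axis i 1 $ k * partial k u z) = partial i u z" for z
    by (simp add: axis_def if_distrib[of "\<lambda>c. c * _"] cong: if_cong)
  then show ?thesis
    using has_real_derivative_along_line[OF assms, of x "axis i 1" t UNIV] by simp
qed

text \<open>The mean value theorem, used once in each coordinate direction. The left side is symmetric in \<open>i\<close>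
  and \<open>j\<close>, the right side prescribes an order of differentiation; this yields Schwarz's theorem.\<close>

lemma mixed_difference_mean_value:
  fixes u :: "real^'n::finite \<Rightarrow> real"
  assumes u: "\<And>x. u differentiable (at x)" and u': "\<And>x. partial i u differentiable (at x)" and "0 < t"
  shows "\<exists>a b. 0 < a \<and> a < t \<and> 0 < b \<and> b < t \<and>
    u (x + t *\<^sub>R axis i 1 + t *\<^sub>R axis j 1) - u (x + t *\<^sub>R axis i 1) - u (x + t *\<^sub>R axis j 1) + u x
    = t * t * partial j (partial i u) (x + a *\<^sub>R axis i 1 + b *\<^sub>R axis j 1)"
proof -
  define g where "g s = u (x + t *\<^sub>R axis j 1 + s *\<^sub>R axis i 1) - u (x + s *\<^sub>R axis i 1)" for s
  define g' where "g' s = partial i u (x + t *\<^sub>R axis j 1 + s *\<^sub>R axis i 1) - partial i u (x + s *\<^sub>R axis i 1)" for s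
  have "(g has_real_derivative g' s) (at s)" for s
    unfolding g_def[abs_def] g'_def by (intro DERIV_diff has_real_derivative_partial_line u)
  then obtain a where a: "0 < a" "a < t" "g t - g 0 = (t - 0) * g' a"
    using MVT2[OF \<open>0 < t\<close>, of g g'] by blast
  define k where "k s = partial i u (x + a *\<^sub>R axis i 1 + s *\<^sub>R axis j 1)" for s
  define k' where "k' s = partial j (partial i u) (x + a *\<^sub>R axis i 1 + s *\<^sub>R axis j 1)" for s
  have "(k has_real_derivative k' s) (at s)" for s
    unfolding k_def[abs_def] k'_def by (intro has_real_derivative_partial_line u')
  then obtain b where b: "0 < b" "b < t" "k t - k 0 = (t - 0) * k' b"
    using MVT2[OF \<open>0 < t\<close>, of k k'] by blast
  have "g' a = k t - k 0"
    by (simp add: g'_def k_def algebra_simps)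
  then have "g t - g 0 = t * t * k' b"
    using a b by simp
  then show ?thesis
    using a b by (intro exI[of _ a] exI[of _ b]) (simp add: g_def k'_def algebra_simps)
qed

text \<open>Schwarz's theorem. It is indispensable here: second differences of \<open>u\<close> only see the symmetric
  part of the Hessian.\<close>

lemma partial_commute:
  fixes u :: "real^'n::finite \<Rightarrow> real"
  assumes u: "Ck 2 u"
  shows "partial i (partial j u) x = partial j (partial i u) x"
proof -
  note C2 = Ck_2D[OF u]
  have lim: "f \<longlonglongrightarrow> partial j (partial i u) x"
    if f: "\<And>n. \<exists>a b. 0 < a \<and> a < inverse (real (Suc n)) \<and> 0 < b \<and> b < inverse (real (Suc n)) \<and>
        f n = partial j (partial i u) (x + a *\<^sub>R axis i 1 + b *\<^sub>R axis j 1)" for f i j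
  proof -
    obtain a b where ab: "\<And>n. 0 < a n \<and> a n < inverse (real (Suc n)) \<and> 0 < b n \<and> b n < inverse (real (Suc n)) \<and>
        f n = partial j (partial i u) (x + a n *\<^sub>R axis i 1 + b n *\<^sub>R axis j 1)"
      using f by metis
    have "a \<longlonglongrightarrow> 0" "b \<longlonglongrightarrow> 0"
      by (rule tendsto_sandwich[OF _ _ tendsto_const LIMSEQ_inverse_real_of_nat];
          use ab in \<open>auto intro!: always_eventually less_imp_le\<close>)+
    then have "(\<lambda>n. x + a n *\<^sub>R axis i 1 + b n *\<^sub>R axis j 1) \<longlonglongrightarrow> x + 0 *\<^sub>R axis i 1 + 0 *\<^sub>R axis j 1"
      by (intro tendsto_intros)
    then have "(\<lambda>n. partial j (partial i u) (x + a n *\<^sub>R axis i 1 + b n *\<^sub>R axis j 1))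
        \<longlonglongrightarrow> partial j (partial i u) x"
      using continuous_on_tendsto_compose[OF C2(3), of _ x] by simp
    moreover have "f = (\<lambda>n. partial j (partial i u) (x + a n *\<^sub>R axis i 1 + b n *\<^sub>R axis j 1))"
      using ab by blast
    ultimately show ?thesis
      by simp
  qed
  define t where "t n = inverse (real (Suc n))" for n
  define f where "f n = (u (x + t n *\<^sub>R axis i 1 + t n *\<^sub>R axis j 1) - u (x + t n *\<^sub>R axis i 1)
      - u (x + t n *\<^sub>R axis j 1) + u x) / (t n * t n)" for n
  have t: "t n > 0" for n
    by (simp add: t_def)
  have "f \<longlonglongrightarrow> partial j (partial i u) x"
  proof (rule lim)
    fix n
    show "\<exists>a b. 0 < a \<and> a < inverse (real (Suc n)) \<and> 0 < b \<and> b < inverse (real (Suc n)) \<and>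
        f n = partial j (partial i u) (x + a *\<^sub>R axis i 1 + b *\<^sub>R axis j 1)"
      using mixed_difference_mean_value[OF C2(1,2) t[of n], where x = x and i = i and j = j] t[of n]
      unfolding f_def by (fastforce simp: t_def)
  qed
  moreover have "f \<longlonglongrightarrow> partial i (partial j u) x"
  proof (rule lim)
    fix n
    have "f n = (u (x + t n *\<^sub>R axis j 1 + t n *\<^sub>R axis i 1) - u (x + t n *\<^sub>R axis j 1)
      - u (x + t n *\<^sub>R axis i 1) + u x) / (t n * t n)"
      by (simp add: f_def algebra_simps)
    then show "\<exists>a b. 0 < a \<and> a < inverse (real (Suc n)) \<and> 0 < b \<and> b < inverse (real (Suc n)) \<and>
        f n = partial i (partial j u) (x + a *\<^sub>R axis j 1 + b *\<^sub>R axis i 1)"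
      using mixed_difference_mean_value[OF C2(1,2) t[of n], where x = x and i = j and j = i] t[of n]
      by (fastforce simp: t_def)
  qed
  ultimately show ?thesis
    by (rule LIMSEQ_unique[symmetric])
qed

definition quad :: "real^'n^'n \<Rightarrow> real^'n::finite \<Rightarrow> real"
  where "quad A s = s \<bullet> (A *v s)"

lemma quad_sum: "quad A s = (\<Sum>i\<in>UNIV. \<Sum>j\<in>UNIV. A $ i $ j * (s $ i * s $ j))"
  by (simp add: quad_def inner_vec_def matrix_vector_mult_def sum_distrib_left ac_simps)

lemma quad_scaleR: "quad A (r *\<^sub>R s) = r\<^sup>2 * quad A s"
  by (simp add: quad_def power2_eq_square linear_scale)

lemma quad_diff: "quad (A - B) s = quad A s - quad B s"
  by (simp add: quad_def matrix_vector_mult_diff_rdistrib inner_simps)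

text \<open>Cauchy--Schwarz in each row shows that the Frobenius norm bounds the operator norm.\<close>

lemma abs_quad_le: "\<bar>quad A s\<bar> \<le> norm A * (norm s)\<^sup>2"
proof -
  have "norm (A *v s) = L2_set (\<lambda>i. A $ i \<bullet> s) UNIV"
    by (simp add: norm_vec_def matrix_vector_mult_def inner_vec_def L2_set_def)
  also have "\<dots> \<le> L2_set (\<lambda>i. norm (A $ i) * norm s) UNIV"
    by (auto simp: L2_set_def intro!: real_sqrt_le_mono sum_mono abs_le_square_iff[THEN iffD1]
        simp: Cauchy_Schwarz_ineq2 abs_mult)
  also have "\<dots> = norm A * norm s"
    by (simp add: norm_vec_def[of A] L2_set_left_distrib)
  finally have "norm s * norm (A *v s) \<le> norm s * (norm A * norm s)"
    by (rule mult_left_mono) simp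
  then show ?thesis
    using Cauchy_Schwarz_ineq2[of s "A *v s"] by (simp add: quad_def power2_eq_square ac_simps)
qed

text \<open>Taylor's theorem for the even function \<open>t \<mapsto> u (x + t h) + u (x - t h)\<close>, whose first derivative
  vanishes at \<open>0\<close>. The remainder has the same \<open>s\<close> on both sides of \<open>x\<close>.\<close>

lemma second_difference_mean_value:
  fixes u :: "real^'n::finite \<Rightarrow> real"
  assumes u: "Ck 2 u"
  shows "\<exists>s. 0 < s \<and> s < 1 \<and> u (x + h) - 2 * u x + u (x - h) =
    (quad (Hessian u (x + s *\<^sub>R h)) h + quad (Hessian u (x - s *\<^sub>R h)) h) / 2"
proof -
  note C2 = Ck_2D[OF u]
  let ?z = "\<lambda>t. x + t *\<^sub>R h"
  define d1 where "d1 t = (\<Sum>i\<in>UNIV. h $ i * partial i u (?z t))" for t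
  define d2 where "d2 t = quad (Hessian u (?z t)) h" for t
  have D1: "((\<lambda>t. u (?z t)) has_real_derivative d1 t) (at t)" for t
    unfolding d1_def by (rule has_real_derivative_along_line[OF C2(1)])
  have D2: "(d1 has_real_derivative d2 t) (at t)" for t
  proof -
    have "(d1 has_real_derivative (\<Sum>i\<in>UNIV. h $ i * (\<Sum>j\<in>UNIV. h $ j * partial j (partial i u) (?z t)))) (at t)"
      unfolding d1_def[abs_def]
      by (intro DERIV_sum DERIV_cmult has_real_derivative_along_line[OF C2(2)])
    moreover have "(\<Sum>i\<in>UNIV. h $ i * (\<Sum>j\<in>UNIV. h $ j * partial j (partial i u) (?z t))) = d2 t"
      by (simp add: d2_def quad_sum Hessian_def partial_commute[OF u] sum_distrib_left ac_simps)
    ultimately show ?thesis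
      by simp
  qed
  \<comment> \<open>The derivatives of order 0, 1 and 2 of the even function.\<close>
  define diff where "diff m t =
    (case m of 0 \<Rightarrow> u (?z t) + u (?z (- t)) | Suc 0 \<Rightarrow> d1 t - d1 (- t) | _ \<Rightarrow> d2 t + d2 (- t))"
    for m :: nat and t :: real
  have "\<forall>m t. m < 2 \<and> 0 \<le> t \<and> t \<le> 1 \<longrightarrow> DERIV (diff m) t :> diff (Suc m) t"
  proof safe
    fix m :: nat and t :: real assume "m < 2"
    have D1': "((\<lambda>t. u (?z (- t))) has_real_derivative - d1 (- t)) (at t)"
      using DERIV_chain'[OF DERIV_minus[OF DERIV_ident] D1[of "- t"]] by simp
    have D2': "((\<lambda>t. d1 (- t)) has_real_derivative - d2 (- t)) (at t)"
      using DERIV_chain'[OF DERIV_minus[OF DERIV_ident] D2[of "- t"]] by simp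
    from \<open>m < 2\<close> consider "m = 0" | "m = 1"
      by linarith
    then show "DERIV (diff m) t :> diff (Suc m) t"
    proof cases
      case 1
      then show ?thesis
        using DERIV_add[OF D1 D1'] by (simp add: diff_def[abs_def])
    next
      case 2
      then show ?thesis
        using DERIV_diff[OF D2 D2'] by (simp add: diff_def[abs_def])
    qed
  qed
  then obtain s where s: "0 < s" "s < 1"
    "diff 0 1 = (\<Sum>m<2. diff m 0 / fact m * 1 ^ m) + diff 2 s / fact 2 * 1 ^ 2"
    using Maclaurin[of 1 2 diff "diff 0"] by auto
  then have "u (x + h) + u (x - h) = 2 * u x + (d2 s + d2 (- s)) / 2"
    by (simp add: diff_def numeral_2_eq_2)
  then have "u (x + h) - 2 * u x + u (x - h) = (d2 s + d2 (- s)) / 2"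
    by linarith
  then show ?thesis
    using s(1,2) by (intro exI[of _ s]) (simp add: d2_def)
qed

lemma continuous_on_Hessian: "Ck 2 u \<Longrightarrow> continuous_on S (Hessian u)"
  unfolding Hessian_def[abs_def]
  by (intro continuous_on_vec_lambda continuous_on_subset[OF Ck_2D(3)]) auto

lemma partial_zero_on_open:
  fixes u :: "real^'n::finite \<Rightarrow> real"
  assumes "open S" "x \<in> S" "\<And>y. y \<in> S \<Longrightarrow> u y = 0"
  shows "partial i u x = 0"
proof -
  have "(u has_derivative (\<lambda>_. 0)) (at x)"
    by (rule has_derivative_transform_within_open[OF has_derivative_const assms(1,2)])
       (simp add: assms(3))
  then show ?thesis
    by (simp add: partial_def flip: frechet_derivative_at)
qed

lemma compactly_supported_radius:
  fixes u :: "real^'n::finite \<Rightarrow> real"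
  assumes "compactly_supported u"
  obtains R where "R > 0" "\<And>x. norm x > R \<Longrightarrow> u x = 0" "\<And>x. norm x > R \<Longrightarrow> Hessian u x = 0"
proof -
  have "bounded (closure {x. u x \<noteq> 0})"
    using assms by (simp add: compactly_supported_def compact_imp_bounded)
  then obtain R where R: "R > 0" "\<And>x. x \<in> closure {x. u x \<noteq> 0} \<Longrightarrow> norm x \<le> R"
    by (auto simp: bounded_pos)
  have u0: "u x = 0" if "norm x > R" for x
    using R(2)[of x] closure_subset[of "{x. u x \<noteq> 0}"] that by force
  let ?S = "- cball 0 R :: (real^'n) set"
  have S: "open ?S" "x \<in> ?S \<longleftrightarrow> norm x > R" for x
    by auto
  have partial0: "partial j u x = 0" if "norm x > R" for x j
    by (rule partial_zero_on_open[OF S(1)]) (use that u0 in auto)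
  have "partial i (partial j u) x = 0" if "norm x > R" for x i j
    by (rule partial_zero_on_open[OF S(1)]) (use that partial0 in auto)
  then have "Hessian u x = 0" if "norm x > R" for x
    using that by (simp add: Hessian_def vec_eq_iff)
  then show ?thesis
    using that R(1) u0 by blast
qed

section \<open>Averaging a quadratic form over directions\<close>

text \<open>The trace-corrected tensor weight of the non-local Hessian. It depends on the direction of
  \<open>h\<close> only.\<close>

definition dir_kernel :: "real^'n::finite \<Rightarrow> real^'n^'n"
  where "dir_kernel h = outer_product (sgn h) (sgn h) - (1 / (real CARD('n) + 2)) *\<^sub>R mat 1"

lemma dir_kernel_nth:
  "dir_kernel h $ i $ j =
    sgn h $ i * sgn h $ j - (if i = j then 1 else 0) / (real CARD('n) + 2)" for h :: "real^'n::finite"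
  by (simp add: dir_kernel_def outer_product_def mat_def)

lemma dir_kernel_bounded:
  obtains c where "c > 0" "\<And>h :: real^'n::finite. norm (dir_kernel h) \<le> c"
proof
  let ?c = "(\<Sum>i\<in>(UNIV::'n set). \<Sum>j\<in>(UNIV::'n set). 2 :: real)"
  show "?c > 0"
    by simp
  fix h :: "real^'n"
  have "\<bar>dir_kernel h $ i $ j\<bar> \<le> 2" for i j
  proof -
    have s: "\<bar>sgn h $ k\<bar> \<le> 1" for k
      using component_le_norm_cart[of "sgn h" k] by (auto simp: norm_sgn split: if_splits)
    have "\<bar>sgn h $ i * sgn h $ j\<bar> \<le> 1 * 1"
      unfolding abs_mult by (intro mult_mono s) auto
    moreover have "\<bar>(if i = j then 1 else 0) / (real CARD('n) + 2)\<bar> \<le> 1"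
      by simp
    ultimately show ?thesis
      unfolding dir_kernel_nth by linarith
  qed
  then have "(\<Sum>j\<in>UNIV. \<bar>dir_kernel h $ i $ j\<bar>) \<le> (\<Sum>j\<in>(UNIV::'n set). 2)" for i
    by (intro sum_mono)
  then have "norm (dir_kernel h $ i) \<le> (\<Sum>j\<in>(UNIV::'n set). 2)" for i
    by (intro order_trans[OF norm_le_l1_cart])
  then have "(\<Sum>i\<in>UNIV. norm (dir_kernel h $ i)) \<le> ?c"
    by (intro sum_mono)
  then show "norm (dir_kernel h) \<le> ?c"
    by (intro order_trans[OF L2_set_le_sum[of UNIV "\<lambda>i. norm (dir_kernel h $ i)", folded norm_vec_def]]) auto
qed

lemma borel_measurable_dir_kernel [measurable]: "dir_kernel \<in> borel_measurable borel"
proof -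
  have "continuous_on UNIV (\<lambda>s :: real^'n. outer_product s s - (1 / (real CARD('n) + 2)) *\<^sub>R mat 1)"
    unfolding outer_product_def by (intro continuous_intros)
  then have "(\<lambda>h. (\<lambda>s :: real^'n. outer_product s s - (1 / (real CARD('n) + 2)) *\<^sub>R mat 1) (sgn h)) \<in> borel_measurable borel"
    by (rule borel_measurable_continuous_on) simp
  then show ?thesis
    by (simp add: dir_kernel_def[abs_def])
qed

lemma borel_measurable_quad_sgn [measurable]: "(\<lambda>h. quad A (sgn h)) \<in> borel_measurable borel"
  unfolding quad_def by (intro borel_measurable_continuous_on[of "\<lambda>s. s \<bullet> (A *v s)"])
    (auto intro!: continuous_intros matrix_vector_mult_linear_continuous_on)

lemma abs_quad_sgn_le: "\<bar>quad A (sgn h)\<bar> \<le> norm A"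
  using abs_quad_le[of A "sgn h"] by (auto simp: norm_sgn split: if_splits)

text \<open>This is where the normalisation of the non-local Hessian comes from. For symmetric \<open>A\<close> the fourth
  moments contribute \<open>(2 A + tr(A) I) / (N (N + 2))\<close>. The second moments, which are
  \<open>\<delta>/N\<close>, turn the correction \<open>- I / (N + 2)\<close> into \<open>- tr(A) I / (N (N + 2))\<close>. The traces cancel and
  the factor \<open>N (N + 2) / 2\<close> leaves \<open>A\<close>.\<close>

lemma angular_average_quad:
  fixes \<rho> :: "real^'n::finite \<Rightarrow> real" and A :: "real^'n^'n"
  assumes rad: "radial \<rho>" and \<rho>: "integrable lebesgue \<rho>" and one: "(LINT h|lebesgue. \<rho> h) = 1"
    and sym: "\<And>i j. A $ i $ j = A $ j $ i"
  shows "(real CARD('n) * (real CARD('n) + 2) / 2) *\<^sub>R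
      (LINT h|lebesgue. (quad A (sgn h) * \<rho> h) *\<^sub>R dir_kernel h) = A"
proof -
  let ?N = "real CARD('n)"
  let ?F = "\<lambda>h. (quad A (sgn h) * \<rho> h) *\<^sub>R dir_kernel h"
  obtain c where c: "c > 0" "\<And>h :: real^'n. norm (dir_kernel h) \<le> c"
    by (rule dir_kernel_bounded) blast
  have "norm (quad A (sgn h) *\<^sub>R dir_kernel h) \<le> norm A * c" for h
    using c(2)[of h] abs_quad_sgn_le[of A h] by (auto intro!: mult_mono)
  from integrable_bounded_mult[OF \<rho> _ this]
  have int_F: "integrable lebesgue ?F"
    by (simp add: mult.commute)
  have "(LINT h|lebesgue. ?F h) $ i $ j = 2 / (?N * (?N + 2)) * A $ i $ j" for i j
  proof -
    let ?\<delta> = "if i = j then 1 else 0 :: real"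
    let ?e = "\<lambda>k. axis k (1::real) :: real^'n"
    let ?m2 = "\<lambda>k l. LINT h|lebesgue. \<rho> h * ((sgn h \<bullet> ?e k) * (sgn h \<bullet> ?e l))"
    have m2: "?m2 k l = (if k = l then 1 else 0) / ?N" for k l
    proof -
      have "?m2 k l = (\<Sum>m\<in>UNIV. angular_moment \<rho> (?e k) (?e l) (?e m) (?e m))"
        by (simp only: sum_angular_moment_axis[OF \<rho>])
      also have "\<dots> = (\<Sum>m\<in>UNIV. (if k = l then 1 + (if m = k then 2 else 0) else 0) / (?N * (?N + 2)))"
        unfolding angular_moment_eq[OF rad \<rho> one] by (intro sum.cong) (auto simp: inner_axis_axis)
      also have "\<dots> = (if k = l then (?N + 2) / (?N * (?N + 2)) else 0)"
        by (simp add: sum.distrib flip: sum_divide_distrib)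
      also have "\<dots> = (if k = l then 1 else 0) / ?N"
        using of_nat_0_le_iff[of "CARD('n)", where 'a = real] by simp
      finally show ?thesis .
    qed
    have "bounded_linear (\<lambda>M :: real^'n^'n. M $ i $ j)"
      by (rule bounded_linear_compose[OF bounded_linear_vec_nth bounded_linear_vec_nth])
    then have "(LINT h|lebesgue. ?F h) $ i $ j = (LINT h|lebesgue. ?F h $ i $ j)"
      using int_F by (rule integral_bounded_linear[symmetric])
    also have "\<dots> = (LINT h|lebesgue. (\<Sum>k\<in>UNIV. \<Sum>l\<in>UNIV.
        A $ k $ l * (\<rho> h * ((sgn h \<bullet> ?e k) * (sgn h \<bullet> ?e l) * (sgn h \<bullet> ?e i) * (sgn h \<bullet> ?e j)))
        - (?\<delta> / (?N + 2)) * A $ k $ l * (\<rho> h * ((sgn h \<bullet> ?e k) * (sgn h \<bullet> ?e l)))))"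
      by (intro Bochner_Integration.integral_cong)
         (simp_all add: quad_sum dir_kernel_nth inner_axis sum_distrib_right sum_distrib_left
           algebra_simps flip: sum_subtractf)
    also have "\<dots> = (\<Sum>k\<in>UNIV. \<Sum>l\<in>UNIV. A $ k $ l * angular_moment \<rho> (?e k) (?e l) (?e i) (?e j)
        - (?\<delta> / (?N + 2)) * A $ k $ l * ?m2 k l)"
      using integrable_angular_moment[OF \<rho>] integrable_angular_moment2[OF \<rho>]
      by (simp add: angular_moment_def)
    also have "\<dots> = (\<Sum>k\<in>UNIV. \<Sum>l\<in>UNIV.
        ((if k = i then if l = j then A $ k $ l else 0 else 0)
          + (if k = j then if l = i then A $ k $ l else 0 else 0)) / (?N * (?N + 2)))"
      unfolding m2 angular_moment_eq[OF rad \<rho> one]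
      by (intro sum.cong refl) (auto simp: inner_axis_axis field_simps)
    also have "\<dots> = (A $ i $ j + A $ j $ i) / (?N * (?N + 2))"
    proof -
      have "(\<Sum>k\<in>UNIV. \<Sum>l\<in>UNIV. if k = a then if l = b then A $ k $ l else 0 else 0) = A $ a $ b" for a b
      proof -
        have "(\<Sum>l\<in>UNIV. if k = a then if l = b then A $ k $ l else 0 else 0)
            = (if k = a then A $ a $ b else 0)" for k
          by simp
        then show ?thesis
          by simp
      qed
      then show ?thesis
        by (simp only: sum.distrib sum_divide_distrib[symmetric])
    qed
    also have "\<dots> = 2 / (?N * (?N + 2)) * A $ i $ j"
      by (simp add: sym[of j i])
    finally show ?thesis .
  qed
  then show ?thesis
    by (simp add: vec_eq_iff)
qed

section \<open>The Taylor error\<close>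

definition second_quotient :: "(real^'n::finite \<Rightarrow> real) \<Rightarrow> real^'n \<Rightarrow> real^'n \<Rightarrow> real"
  where "second_quotient u x h = (u (x + h) - 2 * u x + u (x - h)) / (norm h)\<^sup>2"

text \<open>The difference quotient minus its limit, as a function of the point and the step.
  Everything that remains to be shown is an estimate of its average over \<open>h\<close>.\<close>

definition taylor_error :: "(real^'n::finite \<Rightarrow> real) \<Rightarrow> real^'n \<Rightarrow> real^'n \<Rightarrow> real"
  where "taylor_error u x h = second_quotient u x h - quad (Hessian u x) (sgn h)"

text \<open>At \<open>h = 0\<close> the two integrands agree as well, because both quotients are divisions by zero.\<close>

lemma nonlocal_Hessian_dir_kernel:
  fixes u :: "real^'n::finite \<Rightarrow> real"
  shows "nonlocal_Hessian \<rho> u x = (real CARD('n) * (real CARD('n) + 2) / 2) *\<^sub>R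
    (LINT h|lebesgue. (second_quotient u x h * \<rho> h) *\<^sub>R dir_kernel h)"
proof -
  have "(((u (x + h) - 2 * u x + u (x - h)) / (norm h)\<^sup>2) * \<rho> h) *\<^sub>R
      ((1 / (norm h)\<^sup>2) *\<^sub>R (outer_product h h - ((norm h)\<^sup>2 / (real CARD('n) + 2)) *\<^sub>R mat 1))
      = (second_quotient u x h * \<rho> h) *\<^sub>R dir_kernel h" for h
  proof (cases "h = 0")
    case True
    then show ?thesis
      by (simp add: second_quotient_def)
  next
    case False
    then have "(1 / (norm h)\<^sup>2) *\<^sub>R (outer_product h h - ((norm h)\<^sup>2 / (real CARD('n) + 2)) *\<^sub>R mat 1)
        = dir_kernel h"
      by (simp add: vec_eq_iff dir_kernel_nth outer_product_def mat_def sgn_div_norm power2_eq_square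
          divide_simps)
    then show ?thesis
      by (simp add: second_quotient_def)
  qed
  then show ?thesis
    unfolding nonlocal_Hessian_def by simp
qed

lemma borel_measurable_Hessian_component:
  assumes "Ck 2 u"
  shows "(\<lambda>x. Hessian u x $ i $ j) \<in> borel_measurable borel"
  unfolding Hessian_def using Ck_2D(3)[OF assms] by (auto intro: borel_measurable_continuous_onI)

lemma borel_measurable_taylor_error:
  fixes u :: "real^'n::finite \<Rightarrow> real"
  assumes u: "Ck 2 u"
  shows "(\<lambda>(x, h). taylor_error u x h) \<in> borel_measurable (borel \<Otimes>\<^sub>M borel)"
proof -
  have [measurable]: "u \<in> borel_measurable borel"
    using Ck_2D(4)[OF u] by (rule borel_measurable_continuous_onI)
  note borel_measurable_Hessian_component[OF u, measurable]
  have [measurable]: "(\<lambda>s :: real^'n. s $ i) \<in> borel_measurable borel" for i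
    by (intro borel_measurable_continuous_onI continuous_intros)
  show ?thesis
    unfolding taylor_error_def second_quotient_def quad_sum by measurable
qed

lemma compact_support_bounded_integrable:
  fixes f :: "'a::euclidean_space \<Rightarrow> 'b::{banach, second_countable_topology}"
  assumes f: "continuous_on UNIV f" "\<And>x. norm x > R \<Longrightarrow> f x = 0"
  shows "bounded (range f)" "integrable lborel f"
proof -
  have cont: "continuous_on (cball 0 R) f"
    by (rule continuous_on_subset[OF f(1)]) simp
  have "range f \<subseteq> insert 0 (f ` cball 0 R)"
    using f(2) by (force simp: not_le[symmetric])
  then show "bounded (range f)"
    by (rule bounded_subset[rotated]) (simp add: compact_imp_bounded compact_continuous_image[OF cont])
  have "integrable lborel (\<lambda>x. indicator (cball 0 R) x *\<^sub>R f x)"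
    using cont by (rule borel_integrable_compact[OF compact_cball])
  moreover have "(\<lambda>x. indicator (cball 0 R) x *\<^sub>R f x) = f"
    using f(2) by (auto simp: fun_eq_iff indicator_def not_le)
  ultimately show "integrable lborel f"
    by simp
qed

lemma second_quotient_mean_value:
  fixes u :: "real^'n::finite \<Rightarrow> real"
  assumes u: "Ck 2 u" and "h \<noteq> 0"
  shows "\<exists>s. 0 < s \<and> s < 1 \<and> second_quotient u x h =
    (quad (Hessian u (x + s *\<^sub>R h)) (sgn h) + quad (Hessian u (x - s *\<^sub>R h)) (sgn h)) / 2"
proof -
  obtain s where s: "0 < s" "s < 1" "u (x + h) - 2 * u x + u (x - h) =
      (quad (Hessian u (x + s *\<^sub>R h)) h + quad (Hessian u (x - s *\<^sub>R h)) h) / 2"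
    using second_difference_mean_value[OF u] by blast
  have "quad A (sgn h) = quad A h / (norm h)\<^sup>2" for A :: "real^'n^'n"
    by (simp add: sgn_div_norm quad_scaleR power_inverse divide_inverse mult.commute)
  then show ?thesis
    using s by (intro exI[of _ s]) (simp add: second_quotient_def add_divide_distrib)
qed

text \<open>The error is a mean of \<open>D\<^sup>2u(x \<plusminus> sh) - D\<^sup>2u(x)\<close> in direction \<open>h\<close>, so uniform continuity of the
  Hessian makes it small. As \<open>\<delta>\<close> is chosen at most \<open>1\<close>, it vanishes off the ball of radius
  \<open>R + 1\<close>; the indicator is what makes the error small in \<open>L\<^sup>1\<close>, too.\<close>

lemma taylor_error_small_step:
  fixes u :: "real^'n::finite \<Rightarrow> real"
  assumes u: "Ck 2 u" and supp: "\<And>x. norm x > R \<Longrightarrow> Hessian u x = 0" and "0 < \<epsilon>"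
  shows "\<exists>\<delta>>0. \<forall>h x. norm h \<le> \<delta> \<longrightarrow> \<bar>taylor_error u x h\<bar> \<le> \<epsilon> * indicator (cball 0 (R + 1)) x"
proof -
  have "uniformly_continuous_on (cball 0 (R + 2)) (Hessian u)"
    by (intro compact_uniformly_continuous continuous_on_Hessian u) simp
  then obtain d where d: "d > 0" "\<And>x y. \<lbrakk>norm x \<le> R + 2; norm y \<le> R + 2; dist y x < d\<rbrakk>
      \<Longrightarrow> dist (Hessian u y) (Hessian u x) < \<epsilon>"
    unfolding uniformly_continuous_on_def using \<open>0 < \<epsilon>\<close> by (metis mem_cball_0)
  define \<delta> where "\<delta> = min 1 (d / 2)"
  have \<delta>: "0 < \<delta>" "\<delta> \<le> 1" "\<delta> < d"
    using d(1) by (auto simp: \<delta>_def)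
  have "\<bar>taylor_error u x h\<bar> \<le> \<epsilon> * indicator (cball 0 (R + 1)) x" if h: "norm h \<le> \<delta>" for x h
  proof (cases "h = 0")
    case True
    then show ?thesis
      using \<open>0 < \<epsilon>\<close> by (simp add: taylor_error_def second_quotient_def quad_def indicator_def)
  next
    case False
    obtain s where s: "0 < s" "s < 1" "second_quotient u x h =
      (quad (Hessian u (x + s *\<^sub>R h)) (sgn h) + quad (Hessian u (x - s *\<^sub>R h)) (sgn h)) / 2"
      using second_quotient_mean_value[OF u False] by blast
    let ?A = "Hessian u x" and ?B = "Hessian u (x + s *\<^sub>R h)" and ?C = "Hessian u (x - s *\<^sub>R h)"
    have "s * norm h \<le> 1 * norm h"
      using s by (intro mult_right_mono) auto
    then have sh: "norm (s *\<^sub>R h) \<le> \<delta>"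
      using s h by simp
    have "\<bar>taylor_error u x h\<bar> = \<bar>quad (?B - ?A) (sgn h) + quad (?C - ?A) (sgn h)\<bar> / 2"
      by (simp add: taylor_error_def s(3) quad_diff field_simps)
    also have "\<dots> \<le> (norm (?B - ?A) + norm (?C - ?A)) / 2"
      by (intro divide_right_mono order_trans[OF abs_triangle_ineq] add_mono abs_quad_sgn_le) simp
    finally have bound: "\<bar>taylor_error u x h\<bar> \<le> (norm (?B - ?A) + norm (?C - ?A)) / 2" .
    have tri: "norm (x + s *\<^sub>R h) \<le> norm x + \<delta>" "norm (x - s *\<^sub>R h) \<le> norm x + \<delta>"
        "norm x - \<delta> \<le> norm (x + s *\<^sub>R h)" "norm x - \<delta> \<le> norm (x - s *\<^sub>R h)"
      using sh norm_triangle_ineq[of x "s *\<^sub>R h"] norm_triangle_ineq4[of x "s *\<^sub>R h"]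
        norm_diff_ineq[of x "s *\<^sub>R h"] norm_triangle_ineq2[of x "s *\<^sub>R h"] by linarith+
    show ?thesis
    proof (cases "norm x \<le> R + 1")
      case True
      have "dist ?B ?A < \<epsilon>" "dist ?C ?A < \<epsilon>"
        using True tri sh \<delta> by (intro d(2); simp add: dist_norm)+
      then show ?thesis
        using bound True by (simp add: dist_norm)
    next
      case False
      then have "?A = 0" "?B = 0" "?C = 0"
        using tri \<delta> by (auto intro!: supp)
      then show ?thesis
        using bound False by simp
    qed
  qed
  then show ?thesis
    using \<delta> by blast
qed

text \<open>For steps bounded away from \<open>0\<close> there is no smallness, but a bound by translates of \<open>u\<close>, whose
  supremum and integral do not depend on \<open>h\<close>.\<close>

lemma taylor_error_large_step:
  fixes u :: "real^'n::finite \<Rightarrow> real"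
  assumes "0 < \<delta>" "\<delta> < norm h"
  shows "\<bar>taylor_error u x h\<bar> \<le> (\<bar>u (x + h)\<bar> + 2 * \<bar>u x\<bar> + \<bar>u (x - h)\<bar>) / \<delta>\<^sup>2 + norm (Hessian u x)"
proof -
  have "\<bar>second_quotient u x h\<bar> = \<bar>u (x + h) - 2 * u x + u (x - h)\<bar> / (norm h)\<^sup>2"
    by (simp add: second_quotient_def)
  also have "\<dots> \<le> (\<bar>u (x + h)\<bar> + 2 * \<bar>u x\<bar> + \<bar>u (x - h)\<bar>) / \<delta>\<^sup>2"
    using assms by (intro frac_le power_mono) auto
  finally show ?thesis
    using abs_quad_sgn_le[of "Hessian u x" h] unfolding taylor_error_def by linarith
qed

text \<open>Both regimes in one majorant that serves for the supremum and for the \<open>L\<^sup>1\<close>-norm in \<open>x\<close>.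
  Its average against \<open>\<rho>\<close> is \<open>\<epsilon>\<close> plus \<open>K\<close> times the mass of \<open>\<rho>\<close> outside the ball of radius \<open>\<delta>\<close>.\<close>

lemma taylor_error_bounds:
  fixes u :: "real^'n::finite \<Rightarrow> real"
  assumes u: "Ck 2 u" and supp: "compactly_supported u" and "0 < \<epsilon>"
  obtains \<delta> K where "0 < \<delta>" "0 \<le> K"
    "\<And>h x. \<bar>taylor_error u x h\<bar> \<le> \<epsilon> + K * indicator {h. norm h > \<delta>} h"
    "\<And>h. (\<integral>\<^sup>+x. ennreal \<bar>taylor_error u x h\<bar> \<partial>lborel) \<le> ennreal (\<epsilon> + K * indicator {h. norm h > \<delta>} h)"
proof -
  obtain R where R: "R > 0" "\<And>x. norm x > R \<Longrightarrow> u x = 0" "\<And>x. norm x > R \<Longrightarrow> Hessian u x = 0"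
    using compactly_supported_radius[OF supp] by blast
  note u_bi = compact_support_bounded_integrable[OF Ck_2D(4)[OF u] R(2)]
  note H_bi = compact_support_bounded_integrable[OF continuous_on_Hessian[OF u] R(3)]
  obtain U where U: "\<And>x. \<bar>u x\<bar> \<le> U"
    using u_bi(1) by (auto simp: bounded_iff)
  obtain M where M: "\<And>x. norm (Hessian u x) \<le> M"
    using H_bi(1) by (auto simp: bounded_iff)
  have [measurable]: "u \<in> borel_measurable borel" "Hessian u \<in> borel_measurable borel"
    using u_bi(2) H_bi(2) by auto
  define IU where "IU = (LINT x|lborel. \<bar>u x\<bar>)"
  define IH where "IH = (LINT x|lborel. norm (Hessian u x))"
  have IU: "IU \<ge> 0" "(\<integral>\<^sup>+x. ennreal \<bar>u x\<bar> \<partial>lborel) = ennreal IU"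
    using u_bi(2) by (auto simp: IU_def nn_integral_eq_integral)
  have IH: "IH \<ge> 0" "(\<integral>\<^sup>+x. ennreal (norm (Hessian u x)) \<partial>lborel) = ennreal IH"
    using H_bi(2) by (auto simp: IH_def nn_integral_eq_integral)
  define V where "V = measure lborel (cball (0::real^'n) (R + 1))"
  have V: "V \<ge> 0" "emeasure lborel (cball (0::real^'n) (R + 1)) = ennreal V"
    using emeasure_lborel_cball_finite[of "0::real^'n" "R + 1"]
    by (auto simp: V_def emeasure_eq_ennreal_measure)
  \<comment> \<open>Small enough for the supremum, and for the integral over a set of volume \<open>V\<close>.\<close>
  define \<eta> where "\<eta> = \<epsilon> / (1 + V)"
  have \<eta>: "0 < \<eta>" "\<eta> \<le> \<epsilon>" "\<eta> * V \<le> \<epsilon>"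
    using \<open>0 < \<epsilon>\<close> V(1) by (auto simp: \<eta>_def field_simps)
  obtain \<delta> where \<delta>: "\<delta> > 0"
    "\<And>h x. norm h \<le> \<delta> \<Longrightarrow> \<bar>taylor_error u x h\<bar> \<le> \<eta> * indicator (cball 0 (R + 1)) x"
    using taylor_error_small_step[OF u R(3) \<eta>(1)] by blast
  define K where "K = max (4 * U / \<delta>\<^sup>2 + M) (4 * IU / \<delta>\<^sup>2 + IH)"
  have K: "4 * U / \<delta>\<^sup>2 + M \<le> K" "4 * IU / \<delta>\<^sup>2 + IH \<le> K" "0 \<le> K"
    using IU(1) IH(1) by (auto simp: K_def le_max_iff_disj)
  show ?thesis
  proof (rule that[OF \<delta>(1) K(3)])
    fix h x :: "real^'n"
    show "\<bar>taylor_error u x h\<bar> \<le> \<epsilon> + K * indicator {h. norm h > \<delta>} h"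
    proof (cases "norm h \<le> \<delta>")
      case True
      have "\<bar>taylor_error u x h\<bar> \<le> \<eta> * indicator (cball 0 (R + 1)) x"
        by (rule \<delta>(2)[OF True])
      also have "\<dots> \<le> \<epsilon>"
        using \<eta> by (auto simp: indicator_def)
      finally show ?thesis
        using True by simp
    next
      case False
      then have "\<bar>taylor_error u x h\<bar>
          \<le> (\<bar>u (x + h)\<bar> + 2 * \<bar>u x\<bar> + \<bar>u (x - h)\<bar>) / \<delta>\<^sup>2 + norm (Hessian u x)"
        using \<delta>(1) by (intro taylor_error_large_step) auto
      also have "\<dots> \<le> 4 * U / \<delta>\<^sup>2 + M"
        using U[of "x + h"] U[of x] U[of "x - h"] M by (intro add_mono divide_right_mono) auto
      finally show ?thesis
        using False K(1) \<open>0 < \<epsilon>\<close> by simp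
    qed
  next
    fix h :: "real^'n"
    show "(\<integral>\<^sup>+x. ennreal \<bar>taylor_error u x h\<bar> \<partial>lborel) \<le> ennreal (\<epsilon> + K * indicator {h. norm h > \<delta>} h)"
    proof (cases "norm h \<le> \<delta>")
      case True
      have "ennreal \<bar>taylor_error u x h\<bar> \<le> ennreal \<eta> * indicator (cball 0 (R + 1)) x" for x
        using \<delta>(2)[OF True, of x] by (cases "x \<in> cball 0 (R + 1)") (auto intro: ennreal_leI)
      then have "(\<integral>\<^sup>+x. ennreal \<bar>taylor_error u x h\<bar> \<partial>lborel)
          \<le> (\<integral>\<^sup>+x. ennreal \<eta> * indicator (cball (0::real^'n) (R + 1)) x \<partial>lborel)"
        by (intro nn_integral_mono)
      also have "\<dots> = ennreal (\<eta> * V)"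
        using \<eta>(1) V by (simp add: nn_integral_cmult_indicator ennreal_mult)
      also have "\<dots> \<le> ennreal \<epsilon>"
        using \<eta>(3) by (rule ennreal_leI)
      finally show ?thesis
        using True by simp
    next
      case False
      have shift: "(\<integral>\<^sup>+x. ennreal \<bar>u (z + x)\<bar> \<partial>lborel) = ennreal IU" for z
      proof -
        have "(\<integral>\<^sup>+x. ennreal \<bar>u x\<bar> \<partial>distr lborel borel ((+) z)) = (\<integral>\<^sup>+x. ennreal \<bar>u (z + x)\<bar> \<partial>lborel)"
          by (subst nn_integral_distr) auto
        then show ?thesis
          by (simp add: lborel_distr_plus IU(2))
      qed
      define c where "c = 1 / \<delta>\<^sup>2"
      have c: "c \<ge> 0"
        by (simp add: c_def)
      have "(\<integral>\<^sup>+x. ennreal \<bar>taylor_error u x h\<bar> \<partial>lborel)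
          \<le> (\<integral>\<^sup>+x. ennreal (c * \<bar>u (h + x)\<bar> + 2 * c * \<bar>u x\<bar> + c * \<bar>u (- h + x)\<bar> + norm (Hessian u x)) \<partial>lborel)"
        using taylor_error_large_step[of \<delta> h u] \<delta>(1) False
        by (intro nn_integral_mono ennreal_leI) (simp add: c_def add_divide_distrib add.commute)
      also have "\<dots> = ennreal c * ennreal IU + ennreal (2 * c) * ennreal IU + ennreal c * ennreal IU + ennreal IH"
        using c by (simp add: ennreal_plus ennreal_mult nn_integral_add nn_integral_cmult shift IU(2) IH(2)
            del: ennreal_plus[symmetric] uminus_add_conv_diff)
      also have "\<dots> = ennreal (4 * IU / \<delta>\<^sup>2 + IH)"
        using c IU(1) IH(1) by (simp add: c_def flip: ennreal_mult ennreal_plus)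
      also have "\<dots> \<le> ennreal (\<epsilon> + K)"
        using K(2) \<open>0 < \<epsilon>\<close> by (intro ennreal_leI) simp
      finally show ?thesis
        using False by simp
    qed
  qed
qed

section \<open>Distance of the non-local Hessian from the Hessian\<close>

text \<open>The angular average of the quadratic form of the Hessian is the Hessian itself. Hence only the
  Taylor error is left under the integral.\<close>

lemma nonlocal_Hessian_minus_Hessian:
  fixes u :: "real^'n::finite \<Rightarrow> real"
  assumes rad: "radial \<rho>" and \<rho>: "integrable lebesgue \<rho>" "(LINT h|lebesgue. \<rho> h) = 1"
    and u: "Ck 2 u" and bound: "\<And>h. \<bar>taylor_error u x h\<bar> \<le> B"
  shows "nonlocal_Hessian \<rho> u x - Hessian u x = (real CARD('n) * (real CARD('n) + 2) / 2) *\<^sub>R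
    (LINT h|lebesgue. \<rho> h *\<^sub>R taylor_error u x h *\<^sub>R dir_kernel h)"
    and "integrable lebesgue (\<lambda>h. \<rho> h *\<^sub>R taylor_error u x h *\<^sub>R dir_kernel h)"
proof -
  let ?C = "real CARD('n) * (real CARD('n) + 2) / 2"
  let ?E = "\<lambda>h. \<rho> h *\<^sub>R taylor_error u x h *\<^sub>R dir_kernel h"
  let ?Q = "\<lambda>h. \<rho> h *\<^sub>R quad (Hessian u x) (sgn h) *\<^sub>R dir_kernel h"
  obtain c where c: "c > 0" "\<And>h :: real^'n. norm (dir_kernel h) \<le> c"
    by (rule dir_kernel_bounded) blast
  have [measurable]: "taylor_error u x \<in> borel_measurable borel"
    using measurable_Pair2[OF borel_measurable_taylor_error[OF u], of x] by simp
  have B: "0 \<le> B"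
    by (rule order_trans[OF abs_ge_zero bound])
  have "norm (taylor_error u x h *\<^sub>R dir_kernel h) \<le> B * c" for h
    using c(2)[of h] bound[of h] B by (auto intro!: mult_mono)
  then show E: "integrable lebesgue ?E"
    by (intro integrable_bounded_mult[OF \<rho>(1)]) auto
  have "norm (quad (Hessian u x) (sgn h) *\<^sub>R dir_kernel h) \<le> norm (Hessian u x) * c" for h
    using c(2)[of h] abs_quad_sgn_le[of "Hessian u x" h] by (auto intro!: mult_mono)
  then have Q: "integrable lebesgue ?Q"
    by (intro integrable_bounded_mult[OF \<rho>(1)]) auto
  have "Hessian u x $ i $ j = Hessian u x $ j $ i" for i j
    by (simp add: Hessian_def partial_commute[OF u])
  from angular_average_quad[OF rad \<rho> this]
  have avg: "?C *\<^sub>R (LINT h|lebesgue. ?Q h) = Hessian u x"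
    by (simp add: mult.commute)
  have "nonlocal_Hessian \<rho> u x = ?C *\<^sub>R (LINT h|lebesgue. ?E h + ?Q h)"
    unfolding nonlocal_Hessian_dir_kernel taylor_error_def
    by (intro arg_cong[where f = "scaleR _"] Bochner_Integration.integral_cong refl)
       (simp add: algebra_simps)
  also have "\<dots> = ?C *\<^sub>R (LINT h|lebesgue. ?E h) + ?C *\<^sub>R (LINT h|lebesgue. ?Q h)"
    using E Q by (simp add: scaleR_add_right)
  finally show "nonlocal_Hessian \<rho> u x - Hessian u x = ?C *\<^sub>R (LINT h|lebesgue. ?E h)"
    using avg by simp
qed

text \<open>Tonelli's theorem is applied to the product of two Borel measures, and so requires a Borel density.
  Such a version may fail to be radial, but it enters only after the symmetry of \<open>\<rho>\<close> has been
  used.\<close>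

lemma nonnegative_borel_version:
  fixes \<rho> :: "'a::euclidean_space \<Rightarrow> real"
  assumes "\<rho> \<in> borel_measurable lebesgue" and nonneg: "\<And>x. 0 \<le> \<rho> x"
  obtains \<rho>' where "\<rho>' \<in> borel_measurable borel" "\<And>x. 0 \<le> \<rho>' x" "AE x in lebesgue. \<rho> x = \<rho>' x"
proof -
  obtain g where g: "g \<in> borel_measurable lborel" "AE x in lborel. \<rho> x = g x"
    using completion_ex_borel_measurable_real[OF assms(1)] by blast
  show ?thesis
  proof
    show "(\<lambda>x. max 0 (g x)) \<in> borel_measurable borel"
      using g(1) by simp
    show "0 \<le> max 0 (g x)" for x
      by simp
    have "AE x in lborel. \<rho> x = max 0 (g x)"
      using g(2)
    proof eventually_elim
      case (elim x)
      then show ?case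
        using nonneg[of x] by simp
    qed
    then show "AE x in lebesgue. \<rho> x = max 0 (g x)"
      by (rule AE_completion)
  qed
qed

text \<open>A single number bounds the supremum and the \<open>L\<^sup>1\<close>-norm of the error: the former by integrating the
  pointwise bound \<open>b\<close>, the latter by Tonelli's theorem, integrating over \<open>x\<close> before \<open>h\<close>.\<close>

lemma nonlocal_Hessian_error:
  fixes u :: "real^'n::finite \<Rightarrow> real"
  assumes rad: "radial \<rho>" and nonneg: "\<And>x. 0 \<le> \<rho> x"
    and \<rho>: "integrable lebesgue \<rho>" "(LINT h|lebesgue. \<rho> h) = 1"
    and u: "Ck 2 u"
    and b: "b \<in> borel_measurable borel" "\<And>h. b h \<le> B"
    and sup: "\<And>h x. \<bar>taylor_error u x h\<bar> \<le> b h"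
    and L1: "\<And>h. (\<integral>\<^sup>+x. ennreal \<bar>taylor_error u x h\<bar> \<partial>lborel) \<le> ennreal (b h)"
    and c: "\<And>h :: real^'n. norm (dir_kernel h) \<le> c"
  defines "C \<equiv> real CARD('n) * (real CARD('n) + 2) / 2 * c"
  shows "norm (nonlocal_Hessian \<rho> u x - Hessian u x) \<le> C * (LINT h|lebesgue. \<rho> h * b h)"
    and "integrable lebesgue (\<lambda>x. nonlocal_Hessian \<rho> u x - Hessian u x)"
    and "(LINT x|lebesgue. norm (nonlocal_Hessian \<rho> u x - Hessian u x)) \<le> C * (LINT h|lebesgue. \<rho> h * b h)"
proof -
  let ?A = "real CARD('n) * (real CARD('n) + 2) / 2"
  let ?D = "\<lambda>x. nonlocal_Hessian \<rho> u x - Hessian u x"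
  let ?I = "LINT h|lebesgue. \<rho> h * b h"
  have b0: "0 \<le> b h" for h
    by (rule order_trans[OF abs_ge_zero sup])
  have c0: "0 \<le> c"
    by (rule order_trans[OF norm_ge_zero c])
  have C0: "0 \<le> C"
    using c0 by (simp add: C_def)
  have sup_B: "\<bar>taylor_error u x h\<bar> \<le> B" for x h
    using sup b(2) by (rule order_trans)
  note D = nonlocal_Hessian_minus_Hessian[OF rad \<rho> u sup_B]
  note te [measurable] = borel_measurable_taylor_error[OF u]
  note b(1) [measurable]
  have te_x: "taylor_error u x \<in> borel_measurable borel" for x
    using measurable_Pair2[OF te, of x] by simp
  have int_te: "integrable lebesgue (\<lambda>h. \<rho> h * \<bar>taylor_error u x h\<bar>)" for x
    using integrable_bounded_mult[OF \<rho>(1), of "\<lambda>h. \<bar>taylor_error u x h\<bar>" B] te_x sup_B by simp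
  have int_b: "integrable lebesgue (\<lambda>h. \<rho> h * b h)"
    using integrable_bounded_mult[OF \<rho>(1), of b B] b b0 by simp
  have norm_D: "norm (?D x) \<le> C * (LINT h|lebesgue. \<rho> h * \<bar>taylor_error u x h\<bar>)" for x
  proof -
    have "norm (?D x) = ?A * norm (LINT h|lebesgue. \<rho> h *\<^sub>R taylor_error u x h *\<^sub>R dir_kernel h)"
      unfolding D(1) by simp
    also have "\<dots> \<le> ?A * (LINT h|lebesgue. norm (\<rho> h *\<^sub>R taylor_error u x h *\<^sub>R dir_kernel h))"
      by (intro mult_left_mono integral_norm_bound) auto
    also have "\<dots> \<le> ?A * (LINT h|lebesgue. c * (\<rho> h * \<bar>taylor_error u x h\<bar>))"
    proof (intro mult_left_mono integral_mono)
      show "integrable lebesgue (\<lambda>h. norm (\<rho> h *\<^sub>R taylor_error u x h *\<^sub>R dir_kernel h))"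
        by (rule integrable_norm[OF D(2)])
      show "integrable lebesgue (\<lambda>h. c * (\<rho> h * \<bar>taylor_error u x h\<bar>))"
        using int_te by simp
      show "norm (\<rho> h *\<^sub>R taylor_error u x h *\<^sub>R dir_kernel h) \<le> c * (\<rho> h * \<bar>taylor_error u x h\<bar>)" for h
        using mult_right_mono[OF c[of h], of "\<rho> h * \<bar>taylor_error u x h\<bar>"] nonneg[of h]
        by (simp add: abs_mult ac_simps)
    qed simp
    finally show ?thesis
      by (simp add: C_def)
  qed
  show "norm (?D x) \<le> C * ?I" for x
    using nonneg sup int_te int_b C0
    by (intro order_trans[OF norm_D] mult_left_mono integral_mono) auto
  obtain \<rho>' where \<rho>' [measurable]: "\<rho>' \<in> borel_measurable borel"
    and nonneg': "\<And>h. 0 \<le> \<rho>' h" and AE: "AE h in lebesgue. \<rho> h = \<rho>' h"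
    using nonnegative_borel_version[OF borel_measurable_integrable[OF \<rho>(1)] nonneg] by blast
  have \<rho>'_leb: "\<rho>' \<in> borel_measurable lebesgue"
    by (rule measurable_completion) simp
  \<comment> \<open>Measurability of the error in \<open>x\<close> is read off from an integral over a product of Borel spaces.\<close>
  have D_lborel: "?D = (\<lambda>x. ?A *\<^sub>R (LINT h|lborel. \<rho>' h *\<^sub>R taylor_error u x h *\<^sub>R dir_kernel h))"
  proof
    fix x
    have [measurable]: "(\<lambda>h. \<rho>' h *\<^sub>R taylor_error u x h *\<^sub>R dir_kernel h) \<in> borel_measurable borel"
      using te_x[of x] by simp
    have "(LINT h|lebesgue. \<rho> h *\<^sub>R taylor_error u x h *\<^sub>R dir_kernel h)
        = (LINT h|lebesgue. \<rho>' h *\<^sub>R taylor_error u x h *\<^sub>R dir_kernel h)"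
    proof (rule integral_cong_AE)
      show "(\<lambda>h. \<rho> h *\<^sub>R taylor_error u x h *\<^sub>R dir_kernel h) \<in> borel_measurable lebesgue"
        using D(2)[of x] by simp
      show "(\<lambda>h. \<rho>' h *\<^sub>R taylor_error u x h *\<^sub>R dir_kernel h) \<in> borel_measurable lebesgue"
        by (rule measurable_completion) simp
      show "AE h in lebesgue. \<rho> h *\<^sub>R taylor_error u x h *\<^sub>R dir_kernel h
          = \<rho>' h *\<^sub>R taylor_error u x h *\<^sub>R dir_kernel h"
        using AE by eventually_elim simp
    qed
    also have "\<dots> = (LINT h|lborel. \<rho>' h *\<^sub>R taylor_error u x h *\<^sub>R dir_kernel h)"
      by (rule integral_completion) simp
    finally show "?D x = ?A *\<^sub>R (LINT h|lborel. \<rho>' h *\<^sub>R taylor_error u x h *\<^sub>R dir_kernel h)"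
      unfolding D(1) by simp
  qed
  have D_borel [measurable]: "?D \<in> borel_measurable borel"
  proof -
    have "(\<lambda>(x, h). \<rho>' h *\<^sub>R taylor_error u x h *\<^sub>R dir_kernel h) \<in> borel_measurable (borel \<Otimes>\<^sub>M lborel)"
      by measurable
    from lborel.borel_measurable_lebesgue_integral[OF this] show ?thesis
      unfolding D_lborel by simp
  qed
  have "(\<integral>\<^sup>+x. ennreal (norm (?D x)) \<partial>lebesgue)
      \<le> (\<integral>\<^sup>+x. ennreal (C * (LINT h|lebesgue. \<rho> h * \<bar>taylor_error u x h\<bar>)) \<partial>lborel)"
    unfolding nn_integral_completion by (intro nn_integral_mono ennreal_leI norm_D)
  also have "\<dots> = (\<integral>\<^sup>+x. ennreal C * (\<integral>\<^sup>+h. ennreal (\<rho>' h) * ennreal \<bar>taylor_error u x h\<bar> \<partial>lborel) \<partial>lborel)"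
  proof (rule nn_integral_cong)
    fix x
    have "ennreal (LINT h|lebesgue. \<rho> h * \<bar>taylor_error u x h\<bar>)
        = (\<integral>\<^sup>+h. ennreal (\<rho> h * \<bar>taylor_error u x h\<bar>) \<partial>lebesgue)"
      using int_te nonneg by (intro nn_integral_eq_integral[symmetric]) auto
    also have "\<dots> = (\<integral>\<^sup>+h. ennreal (\<rho>' h) * ennreal \<bar>taylor_error u x h\<bar> \<partial>lebesgue)"
      using AE by (intro nn_integral_cong_AE) (auto elim!: eventually_mono simp: ennreal_mult nonneg')
    finally show "ennreal (C * (LINT h|lebesgue. \<rho> h * \<bar>taylor_error u x h\<bar>))
        = ennreal C * (\<integral>\<^sup>+h. ennreal (\<rho>' h) * ennreal \<bar>taylor_error u x h\<bar> \<partial>lborel)"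
      using C0 nonneg by (simp add: ennreal_mult nn_integral_completion)
  qed
  also have "\<dots> = ennreal C * (\<integral>\<^sup>+x. \<integral>\<^sup>+h. ennreal (\<rho>' h) * ennreal \<bar>taylor_error u x h\<bar> \<partial>lborel \<partial>lborel)"
    by (rule nn_integral_cmult) measurable
  also have "(\<integral>\<^sup>+x. \<integral>\<^sup>+h. ennreal (\<rho>' h) * ennreal \<bar>taylor_error u x h\<bar> \<partial>lborel \<partial>lborel)
      = (\<integral>\<^sup>+h. \<integral>\<^sup>+x. ennreal (\<rho>' h) * ennreal \<bar>taylor_error u x h\<bar> \<partial>lborel \<partial>lborel)"
    by (rule lborel_pair.Fubini'[symmetric]) measurable
  also have "\<dots> \<le> (\<integral>\<^sup>+h. ennreal (\<rho>' h * b h) \<partial>lborel)"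
  proof (rule nn_integral_mono)
    fix h
    have "(\<lambda>x. taylor_error u x h) \<in> borel_measurable borel"
      using measurable_Pair1[OF te, of h] by simp
    then have "(\<integral>\<^sup>+x. ennreal (\<rho>' h) * ennreal \<bar>taylor_error u x h\<bar> \<partial>lborel)
        = ennreal (\<rho>' h) * (\<integral>\<^sup>+x. ennreal \<bar>taylor_error u x h\<bar> \<partial>lborel)"
      by (intro nn_integral_cmult) simp
    also have "\<dots> \<le> ennreal (\<rho>' h) * ennreal (b h)"
      by (intro mult_left_mono L1) simp
    finally show "(\<integral>\<^sup>+x. ennreal (\<rho>' h) * ennreal \<bar>taylor_error u x h\<bar> \<partial>lborel) \<le> ennreal (\<rho>' h * b h)"
      by (simp add: ennreal_mult nonneg' b0)
  qed
  also have "\<dots> = (\<integral>\<^sup>+h. ennreal (\<rho> h * b h) \<partial>lebesgue)"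
    using AE unfolding nn_integral_completion[of lborel, symmetric]
    by (intro nn_integral_cong_AE) (auto elim!: eventually_mono)
  also have "\<dots> = ennreal ?I"
    using int_b nonneg b0 by (intro nn_integral_eq_integral) auto
  finally have nn: "(\<integral>\<^sup>+x. ennreal (norm (?D x)) \<partial>lebesgue) \<le> ennreal (C * ?I)"
    using C0 nonneg b0 by (simp add: ennreal_mult mult_left_mono)
  show int_D: "integrable lebesgue ?D"
    using nn by (intro integrableI_bounded measurable_completion) (auto intro: le_less_trans)
  have "ennreal (LINT x|lebesgue. norm (?D x)) \<le> ennreal (C * ?I)"
    using nn int_D by (subst nn_integral_eq_integral[symmetric]) auto
  moreover have "0 \<le> C * ?I"
    using C0 nonneg b0 by simp
  ultimately show "(LINT x|lebesgue. norm (?D x)) \<le> C * ?I"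
    by simp
qed

section \<open>Convergence of the non-local Hessian\<close>

theorem theorem1p4:
  fixes \<rho> :: "nat \<Rightarrow> real^'n::finite \<Rightarrow> real"
    and u :: "real^'n \<Rightarrow> real"
    and p :: ennreal
  assumes "\<And>n. radial (\<rho> n)"
    and "\<And>n x. \<rho> n x \<ge> 0"
    and "\<And>n. integrable lebesgue (\<rho> n)"
    and "\<And>n. (LINT x|lebesgue. \<rho> n x) = 1"
    and "\<And>\<gamma>. \<gamma> > 0 \<Longrightarrow> (\<lambda>n. LINT x:{x. norm x > \<gamma>}|lebesgue. \<rho> n x) \<longlonglongrightarrow> 0"
    and "Ck 2 u" and "compactly_supported u"
    and "1 \<le> p"
  shows "tendsto_Lp p lebesgue (\<lambda>n. nonlocal_Hessian (\<rho> n) u) (Hessian u)"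
proof -
  note rad = assms(1) and nonneg = assms(2) and int = assms(3) and one = assms(4)
    and tail = assms(5) and u = assms(6) and supp = assms(7)
  let ?D = "\<lambda>n x. nonlocal_Hessian (\<rho> n) u x - Hessian u x"
  obtain c where c: "c > 0" "\<And>h :: real^'n. norm (dir_kernel h) \<le> c"
    by (rule dir_kernel_bounded) blast
  define C where "C = real CARD('n) * (real CARD('n) + 2) / 2 * c"
  have C: "C > 0"
    using c(1) by (simp add: C_def)
  have est: "\<exists>e. (\<forall>n x. norm (?D n x) \<le> e n) \<and> (\<forall>n. integrable lebesgue (?D n)) \<and>
      (\<forall>n. (LINT x|lebesgue. norm (?D n x)) \<le> e n) \<and> (\<forall>\<^sub>F n in sequentially. e n < \<epsilon>)"
    if "0 < \<epsilon>" for \<epsilon> :: real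
  proof -
    \<comment> \<open>Half of \<open>\<epsilon>\<close> is spent on short steps, after multiplication by \<open>C\<close>; the tail \<open>\<tau>\<close> takes the rest.\<close>
    have "0 < \<epsilon> / (2 * C)"
      using that C by simp
    from taylor_error_bounds[OF u supp this] obtain \<delta> K where \<delta>: "0 < \<delta>" "0 \<le> K"
      "\<And>h x. \<bar>taylor_error u x h\<bar> \<le> \<epsilon> / (2 * C) + K * indicator {h. norm h > \<delta>} h"
      "\<And>h. (\<integral>\<^sup>+x. ennreal \<bar>taylor_error u x h\<bar> \<partial>lborel)
        \<le> ennreal (\<epsilon> / (2 * C) + K * indicator {h. norm h > \<delta>} h)"
      by blast
    define b where "b h = \<epsilon> / (2 * C) + K * indicator {h. norm h > \<delta>} h" for h :: "real^'n"
    define \<tau> where "\<tau> n = (LINT x:{x. norm x > \<delta>}|lebesgue. \<rho> n x)" for n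
    have [measurable]: "{h :: real^'n. norm h > \<delta>} \<in> sets borel"
      by measurable
    have b: "b \<in> borel_measurable borel" "\<And>h. b h \<le> \<epsilon> / (2 * C) + K"
      using \<delta>(2) by (auto simp: b_def[abs_def] indicator_def)
    have "(LINT h|lebesgue. \<rho> n h * b h) = \<epsilon> / (2 * C) + K * \<tau> n" for n
    proof -
      have "integrable lebesgue (\<lambda>h. indicator {h. norm h > \<delta>} h *\<^sub>R \<rho> n h)"
        by (rule integrable_mult_indicator[OF _ int]) simp
      then have "(LINT h|lebesgue. \<epsilon> / (2 * C) * \<rho> n h + K * (indicator {h. norm h > \<delta>} h *\<^sub>R \<rho> n h))
          = \<epsilon> / (2 * C) + K * \<tau> n"
        using int one by (simp add: \<tau>_def set_lebesgue_integral_def)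
      then show ?thesis
        by (simp add: b_def algebra_simps)
    qed
    note err = nonlocal_Hessian_error[OF rad nonneg int one u b \<delta>(3,4)[folded b_def] c(2),
        folded C_def, unfolded this]
    have "(\<lambda>n. C * (\<epsilon> / (2 * C) + K * \<tau> n)) \<longlonglongrightarrow> C * (\<epsilon> / (2 * C) + K * 0)"
      unfolding \<tau>_def by (intro tendsto_intros tail \<delta>(1))
    then have "\<forall>\<^sub>F n in sequentially. C * (\<epsilon> / (2 * C) + K * \<tau> n) < \<epsilon>"
      by (rule order_tendstoD) (use C that in simp)
    then show ?thesis
      by (intro exI[of _ "\<lambda>n. C * (\<epsilon> / (2 * C) + K * \<tau> n)"] conjI allI err)
  qed
  obtain R where R: "\<And>x. norm x > R \<Longrightarrow> Hessian u x = 0"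
    using compactly_supported_radius[OF supp] by blast
  note H = compact_support_bounded_integrable[OF continuous_on_Hessian[OF u] R]
  have H_leb: "integrable lebesgue (Hessian u)"
    using H(2) by (simp add: integrable_completion borel_measurable_integrable)
  obtain e where e: "\<And>n x. norm (?D n x) \<le> e n" "\<And>n. integrable lebesgue (?D n)"
    using est[OF zero_less_one] by blast
  have D_bdd: "bounded (range (?D n))" for n
    by (rule boundedI[of _ "e n"]) (auto intro: e(1))
  show ?thesis
  proof (rule tendsto_Lp_uniform_L1[OF _ _ H_leb H(1) _ _ assms(8)])
    fix n
    show "integrable lebesgue (nonlocal_Hessian (\<rho> n) u)"
      using Bochner_Integration.integrable_add[OF e(2)[of n] H_leb] by simp
    show "bounded (range (nonlocal_Hessian (\<rho> n) u))"
      using bounded_plus_comp[OF D_bdd[of n] H(1)] by simp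
  next
    show "uniform_limit UNIV (\<lambda>n. nonlocal_Hessian (\<rho> n) u) (Hessian u) sequentially"
    proof (rule uniform_limitI)
      fix \<epsilon> :: real assume "0 < \<epsilon>"
      then obtain e where e: "\<forall>n x. norm (?D n x) \<le> e n" "\<forall>\<^sub>F n in sequentially. e n < \<epsilon>"
        using est by blast
      from e(2) show "\<forall>\<^sub>F n in sequentially. \<forall>x\<in>UNIV. dist (nonlocal_Hessian (\<rho> n) u x) (Hessian u x) < \<epsilon>"
        by eventually_elim (use e(1) in \<open>auto simp: dist_norm intro: le_less_trans\<close>)
    qed
    show "(\<lambda>n. LINT x|lebesgue. norm (?D n x)) \<longlonglongrightarrow> 0"
    proof (rule tendstoI)
      fix \<epsilon> :: real assume "0 < \<epsilon>"
      then obtain e where e: "\<forall>n. (LINT x|lebesgue. norm (?D n x)) \<le> e n" "\<forall>\<^sub>F n in sequentially. e n < \<epsilon>"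
        using est by blast
      from e(2) show "\<forall>\<^sub>F n in sequentially. dist (LINT x|lebesgue. norm (?D n x)) 0 < \<epsilon>"
        by eventually_elim (use e(1) in \<open>auto intro: le_less_trans\<close>)
    qed
  qed
qed

end
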